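(* Let $k\in\{0,1,2,\dots\}$, $\lambda>0$, $\gamma,\rho\in\mathbb{C}$ and $\psi,\phi\in(0,\pi)$ be such that $$|\rho|\,\bigl(\sin\phi+|\sin(\psi-\phi)|\bigr)<\sin\psi.$$ Then $$ \int_{-\infty}^\infty (1-\rho)^{-\gamma}\ {}_2F_1\!\left(\begin{matrix}\gamma,\ \lambda+ix\\ 2\lambda\end{matrix};\frac{(1-e^{-2i\phi})\rho}{\rho-1}\right)e^{(2\psi-\pi)x}\,|\Gamma(\lambda+ix)|^2\,P_k^{(\lambda)}(x;\psi)\,dx $$ $$ =\left(1-\frac{\rho\sin(\psi-\phi)}{e^{i\phi}\sin\psi}\right)^{-\gamma-k}\left(\frac{\sin\phi}{\sin\psi}\right)^k\frac{(\gamma)_k\,\Gamma(2\lambda)\,2\pi\,\rho^k}{e^{ik\phi}\,(2\sin\psi)^{2\lambda}\,k!}. $$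
   Context: The Pochhammer symbol is $(z)_n=\prod_{i=1}^n(z+i-1)$ (so $(z)_0=1$), and ${}_2F_1(a_1,a_2;b_1;z)=\sum_{n\ge0}\frac{(a_1)_n(a_2)_n}{(b_1)_n}\frac{z^n}{n!}$, continued analytically from $|z|<1$ to $\mathbb{C}\setminus[1,\infty)$. The Meixner-Pollaczek polynomials are $$P_n^{(\lambda)}(x;\phi)=\frac{(2\lambda)_n}{n!}e^{in\phi}\ {}_2F_1\!\left(\begin{matrix}-n,\ \lambda+ix\\ 2\lambda\end{matrix};1-e^{-2i\phi}\right).$$ The assumption on $\rho$ implies $|\rho|<1$; complex powers are taken with the principal branch. *)

theory Defs
  imports "HOL-Complex_Analysis.Complex_Analysis"
begin

definition hyp2F1_series :: "complex \<Rightarrow> complex \<Rightarrow> complex \<Rightarrow> complex \<Rightarrow> complex" where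
  "hyp2F1_series a b c z =
     (\<Sum>n. pochhammer a n * pochhammer b n / pochhammer c n * z ^ n / fact n)"

definition hyp2F1_cut :: "complex set" where
  "hyp2F1_cut = complex_of_real ` {1..}"

text \<open>
  Off the cut, the value of the (unique) holomorphic extension of the series from the unit disc
  to the connected open set \<^term>\<open>- hyp2F1_cut\<close>. On the cut, the value of the series itself; this
  matters only where the series converges there, in particular when it terminates: in the
  Meixner-Pollaczek polynomials below with \<open>\<phi> = \<pi>/2\<close> the argument is \<open>2\<close>.
\<close>

definition hyp2F1 :: "complex \<Rightarrow> complex \<Rightarrow> complex \<Rightarrow> complex \<Rightarrow> complex" where
  "hyp2F1 a b c z =
     (if z \<in> hyp2F1_cut then hyp2F1_series a b c z
      else (THE w. \<exists>F. F holomorphic_on (- hyp2F1_cut) \<and>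
                       (\<forall>u. norm u < 1 \<longrightarrow> F u = hyp2F1_series a b c u) \<and> F z = w))"

definition meixner_pollaczek :: "nat \<Rightarrow> real \<Rightarrow> real \<Rightarrow> real \<Rightarrow> complex" where
  "meixner_pollaczek n lam x \<phi> =
     of_real (pochhammer (2 * lam) n / fact n) * exp (\<i> * of_nat n * of_real \<phi>) *
     hyp2F1 (- of_nat n) (of_real lam + \<i> * of_real x) (of_real (2 * lam))
            (1 - exp (- 2 * \<i> * of_real \<phi>))"

end

theory Submission
  imports Defs "HOL-Probability.Sinc_Integral"
begin

text \<open>
  With \<open>t = e\<^sup>u / (1 + e\<^sup>u)\<close>, Euler's integral writes \<open>|\<Gamma>(\<lambda> + ix)|\<^sup>2\<close> times the hypergeometric factor as
  the Fourier transform in \<open>u\<close> of \<open>t\<^sup>\<lambda> (1 - t)\<^sup>\<lambda> (1 - \<rho> m(u))\<close> to the power \<open>-\<gamma>\<close> (up to constants), where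
  \<open>m = 1 - t + t e\<close> with \<open>e = exp(-2i\<phi>)\<close>. Expanding in \<open>\<rho>\<close> gives a series of Fourier transforms of
  functions that are holomorphic in the strip \<open>|Im u| < \<pi>\<close>. The weight \<open>exp((2\<psi> - \<pi>) x)\<close> turns integration
  over \<open>x\<close> into Fourier inversion at the point \<open>v = i (2\<psi> - \<pi>)\<close> of that strip, and on the line
  \<open>Im u = 2\<psi> - \<pi>\<close> one has \<open>|m| \<le> (sin \<phi> + |sin (\<psi> - \<phi>)|) / sin \<psi>\<close>, so the hypothesis on \<open>\<rho>\<close>
  makes the termwise integration converge. Each term is evaluated by the Chu-Vandermonde
  identity, and the resulting series in \<open>\<rho>\<close> is binomial.
\<close>

section \<open>Integrals depending on a complex parameter\<close>

text \<open>Estimates on the real \<open>u\<close>-axis do not justify interchanging the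
  \<open>x\<close>-integral with the series in \<rho>: there |m| \<le> 1 merely bounds the
  transforms, while the weight may grow almost like exp (pi |x|). The line Im u = 2p - pi gives the
  factor exp (- (2p - pi) x) and the ratio (sin \<phi> + |sin (p - \<phi>)|) / sin p. At p = \<psi>
  this factor exactly cancels the weight and nothing integrable remains; the strict hypothesis
  leaves room for p = \<psi> + \<delta> and p = \<psi> - \<delta>, one for each sign of x, which
  supply exp (- 2 \<delta> |x|). The polynomial is expanded in Pochhammer symbols of \<lambda> + ix,
  because multiplication by them only raises one exponent of the Beta kernel, so each term stays a
  Fourier transform. At v the value of t is the reciprocal of 1 - exp (-2i\<psi>), the argument
  inside P_k; this match between weight and polynomial reduces the sum over the coefficients to a
  2F1 at 1. Its value contains (-m)_k, which vanishes for m < k: this is the origin of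
  \<rho>^k.\<close>

lemma has_field_derivative_integral_param:
  fixes f :: "complex \<Rightarrow> 'a \<Rightarrow> complex"
  assumes r: "r > 0" and G: "integrable M G"
    and meas: "\<And>z. z \<in> ball z0 r \<Longrightarrow> f z \<in> borel_measurable M"
    and hol: "\<And>t. (\<lambda>z. f z t) holomorphic_on ball z0 r"
    and bound: "\<And>z t. z \<in> ball z0 r \<Longrightarrow> norm (f z t) \<le> G t"
  shows "((\<lambda>z. \<integral>t. f z t \<partial>M) has_field_derivative (\<integral>t. deriv (\<lambda>z. f z t) z0 \<partial>M)) (at z0)"
proof -
  have int: "integrable M (f z)" if "z \<in> ball z0 r" for z
    by (rule Bochner_Integration.integrable_bound[OF G meas[OF that]])
       (use bound[OF that] in \<open>auto intro!: always_eventually order.trans[OF _ abs_ge_self]\<close>)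
  \<comment> \<open>Cauchy's inequality on circles of radius s < r/2 bounds the derivative by G t /
    s throughout the half-radius ball; letting s tend to r/2 gives a Lipschitz constant that
    dominates all difference quotients.\<close>
  have lip: "norm (f z t - f z0 t) \<le> (2 / r * G t) * norm (z - z0)" if z: "z \<in> ball z0 (r/2)" for z t
  proof (rule field_differentiable_bound[of "ball z0 (r/2)" "\<lambda>z. f z t" "deriv (\<lambda>z. f z t)"])
    fix w assume w: "w \<in> ball z0 (r/2)"
    have sub: "ball w (r/2) \<subseteq> ball z0 r"
    proof
      fix y assume "y \<in> ball w (r/2)"
      with w show "y \<in> ball z0 r" using dist_triangle[of z0 y w] by (simp add: dist_commute)
    qed
    have w': "w \<in> ball z0 r" using w r by simp
    show "((\<lambda>z. f z t) has_field_derivative deriv (\<lambda>z. f z t) w) (at w within ball z0 (r/2))"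
      using holomorphic_derivI[OF hol[of t] open_ball w'] has_field_derivative_at_within by blast
    show "norm (deriv (\<lambda>z. f z t) w) \<le> 2 / r * G t"
    proof -
      have "norm ((deriv ^^ 1) (\<lambda>z. f z t) w) \<le> fact 1 * G t / s ^ 1" if s: "0 < s" "s < r/2" for s
      proof (rule Cauchy_inequality)
        have sub': "cball w s \<subseteq> ball z0 r" using sub s by (auto intro!: subsetD[OF sub])
        show "(\<lambda>z. f z t) holomorphic_on ball w s"
          by (rule holomorphic_on_subset[OF hol]) (use sub' in auto)
        show "continuous_on (cball w s) (\<lambda>z. f z t)"
          by (rule holomorphic_on_imp_continuous_on, rule holomorphic_on_subset[OF hol sub'])
        show "norm (f x t) \<le> G t" if "norm (w - x) = s" for x
          by (rule bound, rule subsetD[OF sub']) (use that in \<open>simp add: dist_norm\<close>)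
      qed (use s in auto)
      then have *: "\<forall>\<^sub>F s in at_left (r/2). norm (deriv (\<lambda>z. f z t) w) \<le> G t / s"
        using r by (intro eventually_at_leftI[of 0]) auto
      have "((\<lambda>s. G t / s) \<longlongrightarrow> G t / (r/2)) (at_left (r/2))"
        using r by (intro tendsto_intros) auto
      from tendsto_lowerbound[OF this *] show ?thesis by (simp add: field_simps)
    qed
  qed (use z r in auto)
  let ?q = "\<lambda>z t. (f z t - f z0 t) / (z - z0)"
  have "((\<lambda>z. \<integral>t. ?q z t \<partial>M) \<longlongrightarrow> (\<integral>t. deriv (\<lambda>z. f z t) z0 \<partial>M)) (at z0)"
    unfolding tendsto_at_iff_sequentially o_def
  proof (intro allI impI)
    fix X assume X: "\<forall>i. X i \<in> UNIV - {z0}" "X \<longlonglongrightarrow> z0"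
    from X(2) r have "\<forall>\<^sub>F n in sequentially. X n \<in> ball z0 (r/2)"
      by (intro topological_tendstoD) auto
    then obtain N where N: "\<And>n. n \<ge> N \<Longrightarrow> X n \<in> ball z0 (r/2)" by (auto simp: eventually_sequentially)
    have N': "X (n + N) \<in> ball z0 r" for n using N[of "n+N"] r by auto
    have XN: "(\<lambda>n. X (n + N)) \<longlonglongrightarrow> z0" using X(2) by (rule LIMSEQ_ignore_initial_segment)
    have mq: "?q (X (n+N)) \<in> borel_measurable M" for n
      using meas[OF N'[of n]] meas[of z0] r by (intro borel_measurable_divide borel_measurable_diff) auto
    have lim: "(\<lambda>n. ?q (X (n + N)) t) \<longlonglongrightarrow> deriv (\<lambda>z. f z t) z0" for t
    proof -
      have "((\<lambda>z. f z t) has_field_derivative deriv (\<lambda>z. f z t) z0) (at z0)"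
        using holomorphic_derivI[OF hol[of t] open_ball, of z0] r by auto
      then have "((\<lambda>z. ?q z t) \<longlongrightarrow> deriv (\<lambda>z. f z t) z0) (at z0)"
        by (simp add: has_field_derivative_iff)
      then show ?thesis unfolding tendsto_at_iff_sequentially o_def using XN X(1) by auto
    qed
    have "(\<lambda>n. \<integral>t. ?q (X (n + N)) t \<partial>M) \<longlonglongrightarrow> (\<integral>t. deriv (\<lambda>z. f z t) z0 \<partial>M)"
    proof (rule integral_dominated_convergence[where w="\<lambda>t. 2 / r * G t"])
      show "(\<lambda>t. deriv (\<lambda>z. f z t) z0) \<in> borel_measurable M"
        by (rule borel_measurable_LIMSEQ_metric[OF mq lim])
      show "AE t in M. norm (?q (X (n + N)) t) \<le> 2 / r * G t" for n
      proof (rule always_eventually, rule allI)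
        fix t
        have "norm (X (n+N) - z0) > 0" using X(1) by auto
        with lip[OF N[of "n+N"], of t] show "norm (?q (X (n + N)) t) \<le> 2 / r * G t"
          by (simp add: norm_divide divide_le_eq)
      qed
    qed (use G mq lim in auto)
    then show "(\<lambda>n. \<integral>t. ?q (X n) t \<partial>M) \<longlonglongrightarrow> (\<integral>t. deriv (\<lambda>z. f z t) z0 \<partial>M)"
      by (rule LIMSEQ_offset)
  qed
  moreover have "\<forall>\<^sub>F z in at z0. (\<integral>t. ?q z t \<partial>M) = ((\<integral>t. f z t \<partial>M) - (\<integral>t. f z0 t \<partial>M)) / (z - z0)"
  proof -
    have "\<forall>\<^sub>F z in at z0. z \<in> ball z0 r" using r by (intro eventually_at_in_open') auto
    then show ?thesis
      by eventually_elim (use int r in \<open>simp add: Bochner_Integration.integral_diff\<close>)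
  qed
  ultimately show ?thesis
    unfolding has_field_derivative_iff by (rule Lim_transform_eventually)
qed

text \<open>Domination is asked for only near each point, because in the strips and in the slit
  plane of the applications the available bounds degenerate towards the boundary.\<close>

lemma holomorphic_integral_param:
  fixes f :: "complex \<Rightarrow> 'a \<Rightarrow> complex"
  assumes S: "open S"
    and meas: "\<And>z. z \<in> S \<Longrightarrow> f z \<in> borel_measurable M"
    and hol: "\<And>t. (\<lambda>z. f z t) holomorphic_on S"
    and bound: "\<And>z0. z0 \<in> S \<Longrightarrow>
      \<exists>r>0. \<exists>G. integrable M G \<and> (\<forall>z\<in>ball z0 r \<inter> S. \<forall>t. norm (f z t) \<le> G t)"
  shows "(\<lambda>z. \<integral>t. f z t \<partial>M) holomorphic_on S"
    and "z0 \<in> S \<Longrightarrow> ((\<lambda>z. \<integral>t. f z t \<partial>M) has_field_derivative (\<integral>t. deriv (\<lambda>z. f z t) z0 \<partial>M)) (at z0)"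
proof -
  show *: "((\<lambda>z. \<integral>t. f z t \<partial>M) has_field_derivative (\<integral>t. deriv (\<lambda>z. f z t) z0 \<partial>M)) (at z0)"
    if z0: "z0 \<in> S" for z0
  proof -
    obtain r1 where r1: "r1 > 0" "ball z0 r1 \<subseteq> S" using S z0 open_contains_ball by blast
    obtain r2 G where r2: "r2 > 0" "integrable M G" "\<forall>z\<in>ball z0 r2 \<inter> S. \<forall>t. norm (f z t) \<le> G t"
      using bound[OF z0] by blast
    have sub: "ball z0 (min r1 r2) \<subseteq> S" "ball z0 (min r1 r2) \<subseteq> ball z0 r2" using r1 by auto
    show ?thesis
    proof (rule has_field_derivative_integral_param[of "min r1 r2" M G])
      show "(\<lambda>z. f z t) holomorphic_on ball z0 (min r1 r2)" for t
        by (rule holomorphic_on_subset[OF hol sub(1)])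
    qed (use r1 r2 sub meas in auto)
  qed
  show "(\<lambda>z. \<integral>t. f z t \<partial>M) holomorphic_on S"
    by (rule holomorphic_onI) (use * field_differentiable_at_within field_differentiable_def in blast)
qed

section \<open>Fourier inversion for functions holomorphic in a strip\<close>

lemma integrable_exp_neg_abs:
  assumes "\<epsilon> > 0"
  shows "integrable lborel (\<lambda>u::real. exp (- (\<epsilon> * \<bar>u\<bar>)))"
proof -
  let ?f = "\<lambda>u::real. indicator {0<..} u *\<^sub>R exp (- (u * \<epsilon>))"
  have 1: "integrable lborel ?f"
    using integrable_I0i_exp_mscale[OF assms] by (simp add: set_integrable_def)
  have 2: "integrable lborel (\<lambda>u. ?f (0 + (-1) * u))"
    by (rule lborel_integrable_real_affine[OF 1]) auto
  have "integrable lborel (\<lambda>u. ?f u + ?f (0 + (-1) * u))"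
    by (rule Bochner_Integration.integrable_add[OF 1 2])
  then show ?thesis
    by (rule Bochner_Integration.integrable_cong_AE_imp)
       (use AE_lborel_singleton[of 0] in \<open>auto elim!: eventually_mono split: split_indicator simp: mult_ac\<close>)
qed

section \<open>Holomorphic functions of exponential decay in a horizontal strip\<close>

definition strip :: "real \<Rightarrow> complex set" where
  "strip \<beta> = {u. \<bar>Im u\<bar> < \<beta>}"

text \<open>The constants may depend on \<open>b\<close>: for \<open>hker\<close> they blow up as
  the band approaches the singularities at i pi and - i pi. An exponential rate, rather than mere
  integrability, leaves room for differentiation under the integral.\<close>

definition strip_decay :: "real \<Rightarrow> (complex \<Rightarrow> complex) \<Rightarrow> bool" where
  "strip_decay \<beta> H \<longleftrightarrow> H holomorphic_on strip \<beta> \<and>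
     (\<forall>b<\<beta>. \<exists>C>0. \<exists>\<epsilon>>0. \<forall>u. \<bar>Im u\<bar> \<le> b \<longrightarrow> norm (H u) \<le> C * exp (- (\<epsilon> * \<bar>Re u\<bar>)))"

lemma strip_decayE:
  assumes "strip_decay \<beta> H" "b < \<beta>"
  obtains C \<epsilon> where "C > 0" "\<epsilon> > 0" "\<And>u. \<bar>Im u\<bar> \<le> b \<Longrightarrow> norm (H u) \<le> C * exp (- (\<epsilon> * \<bar>Re u\<bar>))"
  using assms unfolding strip_decay_def by blast

lemma open_strip: "open (strip \<beta>)"
proof -
  have "strip \<beta> = {u. Im u < \<beta>} \<inter> {u. Im u > - \<beta>}" by (auto simp: strip_def)
  then show ?thesis by (auto intro!: open_halfspace_Im_lt open_halfspace_Im_gt)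
qed

lemma convex_strip: "convex (strip \<beta>)"
proof -
  have "strip \<beta> = {u. Im u < \<beta>} \<inter> {u. Im u > - \<beta>}" by (auto simp: strip_def)
  then show ?thesis by (simp add: convex_Int convex_halfspace_Im_lt convex_halfspace_Im_gt)
qed

lemma in_strip [simp]: "z \<in> strip \<beta> \<longleftrightarrow> \<bar>Im z\<bar> < \<beta>"
  by (simp add: strip_def)

lemma strip_decay_holomorphic: "strip_decay \<beta> H \<Longrightarrow> H holomorphic_on strip \<beta>"
  by (simp add: strip_decay_def)

lemma strip_decay_line_measurable:
  assumes "strip_decay \<beta> H" "z \<in> strip \<beta>"
  shows "(\<lambda>u::real. H (of_real u + z)) \<in> borel_measurable lborel"
proof -
  have "continuous_on (strip \<beta>) H"
    using strip_decay_holomorphic[OF assms(1)] by (rule holomorphic_on_imp_continuous_on)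
  then have "continuous_on UNIV (\<lambda>u::real. H (of_real u + z))"
    by (rule continuous_on_compose2) (use assms(2) in \<open>auto intro!: continuous_intros\<close>)
  then show ?thesis by (simp add: borel_measurable_continuous_onI)
qed

lemma strip_decay_line_bound:
  assumes H: "strip_decay \<beta> H" and z: "z0 \<in> strip \<beta>"
  obtains r G where "r > 0" "integrable lborel G"
    "\<And>z u. z \<in> ball z0 r \<inter> strip \<beta> \<Longrightarrow> norm (H (of_real u + z)) \<le> G u"
proof -
  \<comment> \<open>Midway between the height of \<open>z0\<close> and the edge, so that a ball of
    radius \<open>r\<close> stays in the band where one decay estimate holds. The factor with |Re
    z0| + r in \<open>?G\<close> pays for the real displacement.\<close>
  define b where "b = (\<bar>Im z0\<bar> + \<beta>) / 2"
  have b: "b < \<beta>" "\<bar>Im z0\<bar> < b" using z by (auto simp: b_def)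
  from strip_decayE[OF H b(1)] obtain C \<epsilon> where
    C: "C > 0" "\<epsilon> > 0" "\<And>u. \<bar>Im u\<bar> \<le> b \<Longrightarrow> norm (H u) \<le> C * exp (- (\<epsilon> * \<bar>Re u\<bar>))" by blast
  define r where "r = b - \<bar>Im z0\<bar>"
  let ?G = "\<lambda>u::real. C * exp (\<epsilon> * (\<bar>Re z0\<bar> + r)) * exp (- (\<epsilon> * \<bar>u\<bar>))"
  show thesis
  proof
    show "r > 0" using b by (simp add: r_def)
    show "integrable lborel ?G" using integrable_exp_neg_abs[OF C(2)] by simp
    fix z u assume "z \<in> ball z0 r \<inter> strip \<beta>"
    then have d: "norm (z - z0) < r" by (simp add: dist_norm norm_minus_commute)
    have i: "\<bar>Im z - Im z0\<bar> < r" using abs_Im_le_cmod[of "z - z0"] d by simp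
    have re: "\<bar>Re z - Re z0\<bar> < r" using abs_Re_le_cmod[of "z - z0"] d by simp
    have "\<bar>Im (of_real u + z)\<bar> \<le> b" using i by (simp add: r_def)
    from C(3)[OF this] have "norm (H (of_real u + z)) \<le> C * exp (- (\<epsilon> * \<bar>u + Re z\<bar>))" by simp
    also have "\<dots> \<le> C * exp (\<epsilon> * (\<bar>Re z0\<bar> + r) + - (\<epsilon> * \<bar>u\<bar>))"
    proof -
      have "\<bar>u\<bar> \<le> \<bar>u + Re z\<bar> + (\<bar>Re z0\<bar> + r)" using re by linarith
      then have "\<epsilon> * \<bar>u\<bar> \<le> \<epsilon> * (\<bar>u + Re z\<bar> + (\<bar>Re z0\<bar> + r))" using C by (intro mult_left_mono) auto
      then show ?thesis using C by (simp add: algebra_simps)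
    qed
    finally show "norm (H (of_real u + z)) \<le> ?G u" by (simp only: exp_add mult_ac)
  qed
qed

lemma strip_decay_integrable:
  assumes "strip_decay \<beta> H" "z \<in> strip \<beta>"
  shows "integrable lborel (\<lambda>u::real. H (of_real u + z))"
proof -
  from strip_decay_line_bound[OF assms] obtain r G where
    G: "r > 0" "integrable lborel G" "\<And>w u. w \<in> ball z r \<inter> strip \<beta> \<Longrightarrow> norm (H (of_real u + w)) \<le> G u"
    by blast
  show ?thesis
    by (rule Bochner_Integration.integrable_bound[OF G(2) strip_decay_line_measurable[OF assms]])
       (use G(1) G(3)[of z] assms(2) in \<open>auto intro!: always_eventually order.trans[OF _ abs_ge_self]\<close>)
qed

text \<open>
  The integral over a shifted line is holomorphic in the shift and, by translation invariance of
  Lebesgue measure, unchanged by real shifts; hence its derivative vanishes.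
\<close>
lemma strip_decay_shift:
  assumes H: "strip_decay \<beta> H" and z: "z \<in> strip \<beta>"
  shows "(\<integral>u. H (of_real u + z) \<partial>lborel) = (\<integral>u. H (of_real u) \<partial>lborel)"
proof -
  define K where "K = (\<lambda>z. \<integral>u. H (of_real u + z) \<partial>lborel)"
  have "(\<lambda>z. \<integral>u. H (of_real u + z) \<partial>lborel) holomorphic_on strip \<beta>"
  proof (rule holomorphic_integral_param(1)[OF open_strip])
    show "(\<lambda>z. H (of_real t + z)) holomorphic_on strip \<beta>" for t
      by (rule holomorphic_on_compose_gen[OF _ strip_decay_holomorphic[OF H], unfolded o_def])
         (auto intro!: holomorphic_intros)
  next
    fix z0 assume "z0 \<in> strip \<beta>"
    from strip_decay_line_bound[OF H this] 
    show "\<exists>r>0. \<exists>G. integrable lborel G \<and> (\<forall>z\<in>ball z0 r \<inter> strip \<beta>. \<forall>t. norm (H (of_real t + z)) \<le> G t)"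
      by metis
  qed (use H strip_decay_line_measurable in auto)
  then have holo: "K holomorphic_on strip \<beta>" by (simp add: K_def)
  have tr: "K (w + of_real r) = K w" for w r
    unfolding K_def
    by (subst lborel_integral_real_affine[where c=1 and t="-r"]) (auto simp: algebra_simps)
  have "(K has_field_derivative 0) (at w within strip \<beta>)" if w: "w \<in> strip \<beta>" for w
  proof -
    have d: "(K has_field_derivative deriv K w) (at w)"
      by (rule holomorphic_derivI[OF holo open_strip w])
    have "((\<lambda>r. K (w + of_real r)) has_vector_derivative 1 * deriv K w) (at (0::real))"
      by (rule field_vector_diff_chain_at[unfolded o_def])
         (use d in \<open>auto intro!: derivative_eq_intros simp: has_vector_derivative_of_real\<close>)
    then have "((\<lambda>r::real. K w) has_vector_derivative deriv K w) (at 0)" by (simp add: tr)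
    then have "deriv K w = 0"
      using has_vector_derivative_const vector_derivative_unique_at by blast
    with d show ?thesis using has_field_derivative_at_within by metis
  qed
  then have "\<exists>c. \<forall>w\<in>strip \<beta>. K w = c"
    using convex_strip by (intro has_field_derivative_zero_constant) auto
  then have "K z = K 0" using z by (metis in_strip abs_zero complex.sel(2) zero_complex.sel(2) le_less_trans abs_ge_zero)
  then show ?thesis by (simp add: K_def)
qed

lemma strip_decay_mult:
  assumes H: "strip_decay \<beta> H" and g: "g holomorphic_on strip \<beta>"
    and bd: "\<And>b. b < \<beta> \<Longrightarrow> \<exists>B. \<forall>u. \<bar>Im u\<bar> \<le> b \<longrightarrow> norm (g u) \<le> B"
  shows "strip_decay \<beta> (\<lambda>u. g u * H u)"
  unfolding strip_decay_def
proof (intro conjI allI impI)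
  show "(\<lambda>u. g u * H u) holomorphic_on strip \<beta>"
    using strip_decay_holomorphic[OF H] g by (intro holomorphic_intros)
  fix b assume b: "b < \<beta>"
  from bd[OF b] obtain B where B: "\<And>u. \<bar>Im u\<bar> \<le> b \<Longrightarrow> norm (g u) \<le> B" by blast
  from strip_decayE[OF H b] obtain C \<epsilon> where
    C: "C > 0" "\<epsilon> > 0" "\<And>u. \<bar>Im u\<bar> \<le> b \<Longrightarrow> norm (H u) \<le> C * exp (- (\<epsilon> * \<bar>Re u\<bar>))" by blast
  have "norm (g u * H u) \<le> (max B 1 * C) * exp (- (\<epsilon> * \<bar>Re u\<bar>))" if u: "\<bar>Im u\<bar> \<le> b" for u
    using mult_mono[of "norm (g u)" "max B 1", OF _ C(3)[OF u]] B[OF u] 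
    by (simp add: norm_mult mult_ac max_def split: if_splits)
  then show "\<exists>C>0. \<exists>\<epsilon>>0. \<forall>u. \<bar>Im u\<bar> \<le> b \<longrightarrow> norm (g u * H u) \<le> C * exp (- (\<epsilon> * \<bar>Re u\<bar>))"
    using C(1,2) by (intro exI[of _ "max B 1 * C"] conjI exI[of _ \<epsilon>]) auto
qed

lemma strip_decay_cmult: "strip_decay \<beta> H \<Longrightarrow> strip_decay \<beta> (\<lambda>u. c * H u)"
  by (rule strip_decay_mult) auto

lemma strip_decay_diff:
  assumes H: "strip_decay \<beta> H" and K: "strip_decay \<beta> K"
  shows "strip_decay \<beta> (\<lambda>u. H u - K u)"
  unfolding strip_decay_def
proof (intro conjI allI impI)
  show "(\<lambda>u. H u - K u) holomorphic_on strip \<beta>"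
    using strip_decay_holomorphic[OF H] strip_decay_holomorphic[OF K] by (intro holomorphic_intros)
  fix b assume b: "b < \<beta>"
  from strip_decayE[OF H b] obtain C \<epsilon> where
    C: "C > 0" "\<epsilon> > 0" "\<And>u. \<bar>Im u\<bar> \<le> b \<Longrightarrow> norm (H u) \<le> C * exp (- (\<epsilon> * \<bar>Re u\<bar>))" by blast
  from strip_decayE[OF K b] obtain D \<delta> where
    D: "D > 0" "\<delta> > 0" "\<And>u. \<bar>Im u\<bar> \<le> b \<Longrightarrow> norm (K u) \<le> D * exp (- (\<delta> * \<bar>Re u\<bar>))" by blast
  have "norm (H u - K u) \<le> (C + D) * exp (- (min \<epsilon> \<delta> * \<bar>Re u\<bar>))" if u: "\<bar>Im u\<bar> \<le> b" for u
  proof -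
    have 1: "C * exp (- (\<epsilon> * \<bar>Re u\<bar>)) \<le> C * exp (- (min \<epsilon> \<delta> * \<bar>Re u\<bar>))"
      using C by (auto intro!: mult_left_mono mult_right_mono)
    have 2: "D * exp (- (\<delta> * \<bar>Re u\<bar>)) \<le> D * exp (- (min \<epsilon> \<delta> * \<bar>Re u\<bar>))"
      using D by (auto intro!: mult_left_mono mult_right_mono)
    have "norm (H u - K u) \<le> norm (H u) + norm (K u)" by (rule norm_triangle_ineq4)
    with 1 2 C(3)[OF u] D(3)[OF u] show ?thesis by (simp add: distrib_right)
  qed
  then show "\<exists>C>0. \<exists>\<epsilon>>0. \<forall>u. \<bar>Im u\<bar> \<le> b \<longrightarrow> norm (H u - K u) \<le> C * exp (- (\<epsilon> * \<bar>Re u\<bar>))"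
    using C(1,2) D(1,2) by (intro exI[of _ "C + D"] conjI exI[of _ "min \<epsilon> \<delta>"]) auto
qed

lemma strip_decay_exp_mult:
  assumes H: "strip_decay \<beta> H"
  shows "strip_decay \<beta> (\<lambda>u. exp (\<i> * of_real x * u) * H u)"
proof (rule strip_decay_mult[OF H])
  fix b assume "b < \<beta>"
  have "norm (exp (\<i> * of_real x * u)) \<le> exp (\<bar>x\<bar> * b)" if "\<bar>Im u\<bar> \<le> b" for u
  proof -
    have "- (x * Im u) \<le> \<bar>x\<bar> * \<bar>Im u\<bar>" by (metis abs_ge_minus_self abs_mult)
    also have "\<dots> \<le> \<bar>x\<bar> * b" using that by (intro mult_left_mono) auto
    finally show ?thesis by simp
  qed
  then show "\<exists>B. \<forall>u. \<bar>Im u\<bar> \<le> b \<longrightarrow> norm (exp (\<i> * of_real x * u)) \<le> B" by blast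
qed (auto intro!: holomorphic_intros)

text \<open>The argument is a function on the complex plane although only its real-line values
  enter: shifting the line and inversion evaluate it off the axis. With this sign in the exponent,
  inversion at v = i \<theta> carries the real weight exp (\<theta> x).\<close>

definition FT :: "(complex \<Rightarrow> complex) \<Rightarrow> real \<Rightarrow> complex" where
  "FT H x = (\<integral>u. exp (\<i> * of_real x * of_real u) * H (of_real u) \<partial>lborel)"

lemma FT_integrable:
  assumes "strip_decay \<beta> H" "\<beta> > 0"
  shows "integrable lborel (\<lambda>u::real. exp (\<i> * of_real x * of_real u) * H (of_real u))"
  using strip_decay_integrable[OF strip_decay_exp_mult[OF assms(1)], of 0 x] assms(2) by simp

lemma FT_diff:
  assumes "strip_decay \<beta> H" "strip_decay \<beta> K" "\<beta> > 0"
  shows "FT (\<lambda>u. H u - K u) x = FT H x - FT K x"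
  using FT_integrable[OF assms(1,3), of x] FT_integrable[OF assms(2,3), of x]
  by (simp add: FT_def right_diff_distrib)

lemma FT_cmult: "FT (\<lambda>u. c * H u) x = c * FT H x"
proof -
  have "FT (\<lambda>u. c * H u) x = (\<integral>u. c * (exp (\<i> * of_real x * of_real u) * H (of_real u)) \<partial>lborel)"
    by (simp add: FT_def mult_ac)
  then show ?thesis by (simp only: FT_def integral_mult_right_zero)
qed

lemma FT_shift:
  assumes H: "strip_decay \<beta> H" and s: "\<bar>s\<bar> < \<beta>"
  shows "FT H x = exp (- of_real (x * s)) *
           (\<integral>u. exp (\<i> * of_real x * of_real u) * H (of_real u + \<i> * of_real s) \<partial>lborel)"
proof -
  have "FT H x = (\<integral>u. exp (\<i> * of_real x * (of_real u + \<i> * of_real s)) * H (of_real u + \<i> * of_real s) \<partial>lborel)"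
    using strip_decay_shift[OF strip_decay_exp_mult[OF H], of "\<i> * of_real s" x] s
    by (simp add: FT_def)
  also have "\<dots> = (\<integral>u. exp (- of_real (x * s)) * (exp (\<i> * of_real x * of_real u) * H (of_real u + \<i> * of_real s)) \<partial>lborel)"
  proof (rule Bochner_Integration.integral_cong[OF refl])
    fix u :: real
    have "\<i> * of_real x * (of_real u + \<i> * of_real s) = - of_real (x * s) + \<i> * of_real x * of_real u"
      by (simp add: algebra_simps)
    then show "exp (\<i> * of_real x * (of_real u + \<i> * of_real s)) * H (of_real u + \<i> * of_real s) =
      exp (- of_real (x * s)) * (exp (\<i> * of_real x * of_real u) * H (of_real u + \<i> * of_real s))"
      by (simp only: exp_add mult_ac)
  qed
  finally show ?thesis by (simp only: integral_mult_right_zero)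
qed

text \<open>Shifting the line by i s contributes a factor of modulus exp (- x s). The integral over
  the shifted line stays explicit, so that powers of the pencil can later be estimated on that very
  line.\<close>

lemma FT_bound_line:
  assumes H: "strip_decay \<beta> H" and s: "\<bar>s\<bar> < \<beta>"
  shows "norm (FT H x) \<le> exp (- (x * s)) * (\<integral>u. norm (H (of_real u + \<i> * of_real s)) \<partial>lborel)"
proof -
  let ?g = "\<lambda>u::real. exp (\<i> * of_real x * of_real u) * H (of_real u + \<i> * of_real s)"
  have "norm (FT H x) = exp (- (x * s)) * norm (\<integral>u. ?g u \<partial>lborel)"
    by (subst FT_shift[OF H s]) (simp add: norm_mult)
  also have "norm (\<integral>u. ?g u \<partial>lborel) \<le> (\<integral>u. norm (?g u) \<partial>lborel)"
    by (rule integral_norm_bound)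
  also have "\<dots> = (\<integral>u. norm (H (of_real u + \<i> * of_real s)) \<partial>lborel)"
    by (simp add: norm_mult)
  finally show ?thesis by simp
qed

text \<open>The line is raised to height \<open>b\<close> for x \<ge> 0 and lowered to
  \<open>- b\<close> for x < 0.\<close>

lemma FT_decay:
  assumes H: "strip_decay \<beta> H" and b: "0 \<le> b" "b < \<beta>"
  obtains C where "C \<ge> 0" "\<And>x. norm (FT H x) \<le> C * exp (- (b * \<bar>x\<bar>))"
proof
  let ?I = "\<lambda>s. \<integral>u. norm (H (of_real u + \<i> * of_real s)) \<partial>lborel"
  have I: "?I s \<ge> 0" for s by simp
  show "?I b + ?I (- b) \<ge> 0" using I[of b] I[of "-b"] by linarith
  fix x
  have *: "norm (FT H x) \<le> exp (- (x * b)) * ?I b" "norm (FT H x) \<le> exp (- (x * - b)) * ?I (- b)"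
    using FT_bound_line[OF H, of b x] FT_bound_line[OF H, of "-b" x] b by simp_all
  show "norm (FT H x) \<le> (?I b + ?I (- b)) * exp (- (b * \<bar>x\<bar>))"
  proof (cases "x \<ge> 0")
    case True
    then have "norm (FT H x) \<le> exp (- (b * \<bar>x\<bar>)) * ?I b" using *(1) by (simp add: mult_ac)
    also have "\<dots> \<le> exp (- (b * \<bar>x\<bar>)) * (?I b + ?I (- b))"
      using I[of "-b"] by (intro mult_left_mono) auto
    finally show ?thesis by (simp only: mult_ac)
  next
    case False
    then have "norm (FT H x) \<le> exp (- (b * \<bar>x\<bar>)) * ?I (- b)" using *(2) by (simp add: mult_ac)
    also have "\<dots> \<le> exp (- (b * \<bar>x\<bar>)) * (?I b + ?I (- b))"
      using I[of b] by (intro mult_left_mono) auto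
    finally show ?thesis by (simp only: mult_ac)
  qed
qed

text \<open>The parameter is made complex in order to differentiate under the integral. The decay
  rate \<epsilon> of \<open>H\<close> on the real axis dominates the growth exp (\<epsilon>/2 |u|)
  caused by an imaginary part of at most \<epsilon>/2.\<close>

lemma FT_has_vector_derivative:
  assumes H: "strip_decay \<beta> H" and \<beta>: "\<beta> > 0"
  shows "(FT H has_vector_derivative FT (\<lambda>u. \<i> * u * H u) x) (at x)"
proof -
  from strip_decayE[OF H \<beta>] obtain C \<epsilon> where
    C: "C > 0" "\<epsilon> > 0" "\<And>u. \<bar>Im u\<bar> \<le> 0 \<Longrightarrow> norm (H u) \<le> C * exp (- (\<epsilon> * \<bar>Re u\<bar>))" by blast
  let ?f = "\<lambda>z (u::real). exp (\<i> * z * of_real u) * H (of_real u)"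
  have mH: "(\<lambda>u. H (of_real u)) \<in> borel_measurable lborel"
    using strip_decay_line_measurable[OF H, of 0] \<beta> by simp
  have "((\<lambda>z. \<integral>u. ?f z u \<partial>lborel) has_field_derivative (\<integral>u. deriv (\<lambda>z. ?f z u) (of_real x) \<partial>lborel)) (at (of_real x))"
  proof (rule has_field_derivative_integral_param)
    show "\<epsilon>/2 > 0" using C by simp
    show "integrable lborel (\<lambda>u::real. C * exp (- (\<epsilon> / 2 * \<bar>u\<bar>)))"
      using integrable_exp_neg_abs[of "\<epsilon>/2"] C by simp
    show "?f z \<in> borel_measurable lborel" for z
      using mH by (intro borel_measurable_times) simp_all
    show "(\<lambda>z. ?f z t) holomorphic_on ball (of_real x) (\<epsilon>/2)" for t
      by (intro holomorphic_intros)
    fix z :: complex and t :: real assume z: "z \<in> ball (of_real x) (\<epsilon>/2)"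
    have "\<bar>Im z\<bar> \<le> \<epsilon>/2"
      using z abs_Im_le_cmod[of "z - of_real x"] by (simp add: dist_norm norm_minus_commute)
    then have "\<bar>Im z\<bar> * \<bar>t\<bar> \<le> \<epsilon>/2 * \<bar>t\<bar>" by (intro mult_right_mono) auto
    moreover have "- (Im z * t) \<le> \<bar>Im z\<bar> * \<bar>t\<bar>" by (metis abs_ge_minus_self abs_mult)
    ultimately have le: "- (Im z * t) \<le> \<epsilon>/2 * \<bar>t\<bar>" by linarith
    have "norm (?f z t) \<le> exp (\<epsilon>/2 * \<bar>t\<bar>) * (C * exp (- (\<epsilon> * \<bar>t\<bar>)))"
      unfolding norm_mult using C(3)[of "of_real t"] le by (intro mult_mono) auto
    also have "\<dots> = C * exp (\<epsilon>/2 * \<bar>t\<bar> + (- (\<epsilon> * \<bar>t\<bar>)))" by (simp only: exp_add mult_ac)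
    also have "\<epsilon>/2 * \<bar>t\<bar> + (- (\<epsilon> * \<bar>t\<bar>)) = - (\<epsilon>/2 * \<bar>t\<bar>)" by (simp add: field_simps)
    finally show "norm (?f z t) \<le> C * exp (- (\<epsilon>/2 * \<bar>t\<bar>))" .
  qed
  moreover have "deriv (\<lambda>z. ?f z u) (of_real x) = exp (\<i> * of_real x * of_real u) * (\<i> * of_real u * H (of_real u))" for u
    by (rule DERIV_imp_deriv) (auto intro!: derivative_eq_intros)
  ultimately have "((\<lambda>z. \<integral>u. ?f z u \<partial>lborel) has_field_derivative FT (\<lambda>u. \<i> * u * H u) x) (at (of_real x))"
    by (simp add: FT_def)
  then have "((\<lambda>x. \<integral>u. ?f (of_real x) u \<partial>lborel) has_vector_derivative 1 * FT (\<lambda>u. \<i> * u * H u) x) (at x)"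
    by (intro field_vector_diff_chain_at[unfolded o_def, where f=of_real]) (auto intro!: derivative_eq_intros)
  then show ?thesis by (simp add: FT_def[abs_def])
qed

lemma FT_isCont:
  assumes "strip_decay \<beta> H" "\<beta> > 0"
  shows "isCont (FT H) x"
  using FT_has_vector_derivative[OF assms] has_vector_derivative_continuous by blast

lemma FT_measurable:
  assumes "strip_decay \<beta> H" "\<beta> > 0"
  shows "FT H \<in> borel_measurable lborel"
  using FT_isCont[OF assms] by (simp add: borel_measurable_continuous_onI continuous_at_imp_continuous_on)

lemma FT_weighted_bound:
  assumes H: "strip_decay \<beta> H" and v: "\<bar>Im v\<bar> < \<beta>"
  obtains C \<epsilon> where "\<epsilon> > 0" "C \<ge> 0"
    "\<And>x. norm (exp (- \<i> * of_real x * v) * FT H x) \<le> C * exp (- (\<epsilon> * \<bar>x\<bar>))"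
proof -
  \<comment> \<open>A rate strictly between |Im v| and \<beta>: after the exponential has used up
    |Im v|, a positive rate is left.\<close>
  define b where "b = (\<bar>Im v\<bar> + \<beta>) / 2"
  have b: "0 \<le> b" "b < \<beta>" "\<bar>Im v\<bar> < b" using v by (auto simp: b_def)
  from FT_decay[OF H b(1,2)] obtain C where C: "C \<ge> 0" "\<And>x. norm (FT H x) \<le> C * exp (- (b * \<bar>x\<bar>))" by blast
  have "norm (exp (- \<i> * of_real x * v) * FT H x) \<le> C * exp (- ((b - \<bar>Im v\<bar>) * \<bar>x\<bar>))" for x
  proof -
    have "x * Im v \<le> \<bar>x\<bar> * \<bar>Im v\<bar>" by (metis abs_ge_self abs_mult)
    then have "norm (exp (- \<i> * of_real x * v) * FT H x) \<le> exp (\<bar>x\<bar> * \<bar>Im v\<bar>) * (C * exp (- (b * \<bar>x\<bar>)))"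
      unfolding norm_mult using C(2)[of x] by (intro mult_mono) auto
    also have "\<dots> = C * exp (\<bar>x\<bar> * \<bar>Im v\<bar> + (- (b * \<bar>x\<bar>)))" by (simp only: exp_add mult_ac)
    finally show ?thesis by (simp add: algebra_simps)
  qed
  with b C(1) show thesis by (intro that[of "b - \<bar>Im v\<bar>" C]) auto
qed

lemma FT_weighted_integrable:
  assumes H: "strip_decay \<beta> H" and v: "\<bar>Im v\<bar> < \<beta>"
  shows "integrable lborel (\<lambda>x. exp (- \<i> * of_real x * v) * FT H x)"
proof -
  from FT_weighted_bound[OF assms] obtain C \<epsilon> where C: "\<epsilon> > 0" "C \<ge> 0"
    "\<And>x. norm (exp (- \<i> * of_real x * v) * FT H x) \<le> C * exp (- (\<epsilon> * \<bar>x\<bar>))" by blast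
  have [measurable]: "FT H \<in> borel_measurable lborel" using FT_measurable[OF H] v by auto
  show ?thesis
  proof (rule Bochner_Integration.integrable_bound)
    show "integrable lborel (\<lambda>x::real. C * exp (- (\<epsilon> * \<bar>x\<bar>)))" using integrable_exp_neg_abs[OF C(1)] by simp
    show "AE x in lborel. norm (exp (- \<i> * of_real x * v) * FT H x) \<le> norm (C * exp (- (\<epsilon> * \<bar>x\<bar>)))"
      using C by (intro always_eventually allI order.trans[OF C(3)]) auto
  qed measurable
qed

text \<open>Differentiating exp (- i x v) times the transform of \<open>Q\<close> produces i (u - v)
  inside the transform, so i times the integrand is the derivative of a function that tends to 0 at
  both ends.\<close>

lemma FT_inversion_zero:
  assumes Q: "strip_decay \<beta> Q" and H: "strip_decay \<beta> (\<lambda>u. (u - v) * Q u)" and v: "\<bar>Im v\<bar> < \<beta>"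
  shows "(\<integral>x. exp (- \<i> * of_real x * v) * FT (\<lambda>u. (u - v) * Q u) x \<partial>lborel) = 0"
proof -
  have \<beta>: "\<beta> > 0" using v by auto
  let ?F = "\<lambda>x. exp (- \<i> * of_real x * v) * FT Q x"
  let ?f = "\<lambda>x. \<i> * (exp (- \<i> * of_real x * v) * FT (\<lambda>u. (u - v) * Q u) x)"
  from FT_weighted_bound[OF Q v] obtain C \<epsilon> where C: "\<epsilon> > 0" "C \<ge> 0"
    "\<And>x. norm (?F x) \<le> C * exp (- (\<epsilon> * \<bar>x\<bar>))" by blast
  have deriv: "(?F has_vector_derivative ?f x) (at x)" for x
  proof -
    \<comment> \<open>Obtained as (u - v) Q - (- v) Q, so its decay follows from the two
      hypotheses.\<close>
    have uQ: "strip_decay \<beta> (\<lambda>u. u * Q u)"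
      using strip_decay_diff[OF H strip_decay_cmult[OF Q, of "-v"]] by (simp add: algebra_simps)
    have FTe: "FT (\<lambda>u. \<i> * u * Q u) x = \<i> * (FT (\<lambda>u. (u - v) * Q u) x + v * FT Q x)"
    proof -
      have "FT (\<lambda>u. (u - v) * Q u) x = FT (\<lambda>u. u * Q u) x - v * FT Q x"
        using FT_diff[OF uQ strip_decay_cmult[OF Q] \<beta>, of v x] by (simp add: FT_cmult left_diff_distrib)
      moreover have "FT (\<lambda>u. \<i> * u * Q u) x = \<i> * FT (\<lambda>u. u * Q u) x"
        using FT_cmult[of \<i> "\<lambda>u. u * Q u" x] by (simp add: mult.assoc)
      ultimately show ?thesis by simp
    qed
    have e: "((\<lambda>x. exp (- \<i> * of_real x * v)) has_vector_derivative (- \<i> * v) * exp (- \<i> * of_real x * v)) (at x)"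
    proof -
      have "((\<lambda>z. exp (- \<i> * z * v)) has_field_derivative (- \<i> * v) * exp (- \<i> * of_real x * v)) (at (of_real x))"
        by (auto intro!: derivative_eq_intros)
      moreover have "(complex_of_real has_vector_derivative 1) (at x)"
        by (auto intro!: derivative_eq_intros)
      ultimately show ?thesis
        using field_vector_diff_chain_at[of complex_of_real 1 x "\<lambda>z. exp (- \<i> * z * v)"] by (simp add: o_def)
    qed
    have "(?F has_vector_derivative exp (- \<i> * of_real x * v) * FT (\<lambda>u. \<i> * u * Q u) x +
        (- \<i> * v) * exp (- \<i> * of_real x * v) * FT Q x) (at x)"
      by (rule has_vector_derivative_mult[OF e FT_has_vector_derivative[OF Q \<beta>]])
    moreover have "e * (\<i> * (X + v * Y)) + (- \<i> * v) * e * Y = \<i> * (e * X)" for e X Y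
      by (simp add: algebra_simps)
    ultimately show ?thesis by (simp only: FTe)
  qed
  have cont: "isCont ?f x" for x
    using FT_isCont[OF H \<beta>] by (intro continuous_intros) auto
  have int: "integrable lborel ?f"
    using FT_weighted_integrable[OF H v] by simp
  have lims: "(?F \<longlongrightarrow> 0) at_top" "(?F \<longlongrightarrow> 0) at_bot"
  proof -
    have "filterlim (\<lambda>x. \<epsilon> * norm (x::real)) at_top at_infinity"
      by (rule filterlim_tendsto_pos_mult_at_top[OF tendsto_const C(1) filterlim_norm_at_top])
    then have "((\<lambda>x::real. exp (- (\<epsilon> * norm x))) \<longlongrightarrow> 0) at_infinity"
      by (intro filterlim_compose[OF exp_at_bot]) (simp add: filterlim_uminus_at_top)
    then have "((\<lambda>x::real. C * exp (- (\<epsilon> * norm x))) \<longlongrightarrow> C * 0) at_infinity"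
      by (intro tendsto_mult tendsto_const)
    then have *: "((\<lambda>x::real. C * exp (- (\<epsilon> * \<bar>x\<bar>))) \<longlongrightarrow> 0) at_infinity" by simp
    have "(?F \<longlongrightarrow> 0) at_infinity"
      by (rule Lim_null_comparison[OF always_eventually *]) (rule allI, rule C(3))
    then show "(?F \<longlongrightarrow> 0) at_top" "(?F \<longlongrightarrow> 0) at_bot"
      by (rule filterlim_mono[OF _ order_refl at_top_le_at_infinity], rule filterlim_mono[OF _ order_refl at_bot_le_at_infinity])
  qed
  have "(LBINT x=-\<infinity>..\<infinity>. ?f x) = 0 - 0"
    by (rule interval_integral_FTC_integrable[where F="?F"])
       (use deriv cont int lims in \<open>simp_all only: set_integrable_def ereal_tendsto_simps\<close>, simp_all)
  then have "integral\<^sup>L lborel ?f = 0"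
    by (simp add: interval_lebesgue_integral_def set_lebesgue_integral_def)
  then show ?thesis by simp
qed

text \<open>Holomorphy is the removal of the singularity at the zero of \<open>H\<close>. For the
  decay, points with |Re u - Re v| > 1 have |u - v| > 1, where division does no harm; the remaining
  points of the band form a compact rectangle.\<close>

lemma strip_decay_quotient:
  assumes H: "strip_decay \<beta> H" and v: "\<bar>Im v\<bar> < \<beta>" and H0: "H v = 0"
  shows "strip_decay \<beta> (\<lambda>u. if u = v then deriv H v else H u / (u - v))" (is "strip_decay \<beta> ?Q")
  unfolding strip_decay_def
proof (intro conjI allI impI)
  show hol: "?Q holomorphic_on strip \<beta>"
    by (rule pole_theorem_open_0[OF strip_decay_holomorphic[OF H] open_strip, of v]) (use H0 in auto)
  fix b assume b: "b < \<beta>"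
  from strip_decayE[OF H b] obtain C \<epsilon> where
    C: "C > 0" "\<epsilon> > 0" "\<And>u. \<bar>Im u\<bar> \<le> b \<Longrightarrow> norm (H u) \<le> C * exp (- (\<epsilon> * \<bar>Re u\<bar>))" by blast
  let ?S = "cbox (Complex (Re v - 1) (-b)) (Complex (Re v + 1) b)"
  have inS: "u \<in> ?S \<longleftrightarrow> \<bar>Re u - Re v\<bar> \<le> 1 \<and> \<bar>Im u\<bar> \<le> b" for u
    by (auto simp: in_cbox_complex_iff)
  have "continuous_on ?S ?Q"
    by (rule holomorphic_on_imp_continuous_on, rule holomorphic_on_subset[OF hol]) (use b inS in auto)
  then have "bounded (?Q ` ?S)" by (intro compact_imp_bounded compact_continuous_image compact_cbox)
  then obtain B where B: "B > 0" "\<And>u. u \<in> ?S \<Longrightarrow> norm (?Q u) \<le> B" unfolding bounded_pos by blast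
  define D where "D = max C (B * exp (\<epsilon> * (\<bar>Re v\<bar> + 1)))"
  have "norm (?Q u) \<le> D * exp (- (\<epsilon> * \<bar>Re u\<bar>))" if u: "\<bar>Im u\<bar> \<le> b" for u
  proof (cases "\<bar>Re u - Re v\<bar> \<le> 1")
    case True
    then have "norm (?Q u) \<le> B" using B(2) u inS by blast
    also have "\<dots> \<le> B * exp (\<epsilon> * (\<bar>Re v\<bar> + 1) + - (\<epsilon> * \<bar>Re u\<bar>))"
    proof -
      have "\<epsilon> * \<bar>Re u\<bar> \<le> \<epsilon> * (\<bar>Re v\<bar> + 1)" using True C by (intro mult_left_mono) auto
      then show ?thesis using B by simp
    qed
    also have "\<dots> = B * exp (\<epsilon> * (\<bar>Re v\<bar> + 1)) * exp (- (\<epsilon> * \<bar>Re u\<bar>))" by (simp only: exp_add mult_ac)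
    also have "\<dots> \<le> D * exp (- (\<epsilon> * \<bar>Re u\<bar>))" by (intro mult_right_mono) (auto simp: D_def)
    finally show ?thesis .
  next
    case False
    then have ne: "norm (u - v) \<ge> 1" using abs_Re_le_cmod[of "u - v"] by simp
    then have "u \<noteq> v" by auto
    then have "norm (?Q u) = norm (H u) / norm (u - v)" by (simp add: norm_divide)
    also have "\<dots> \<le> norm (H u) / 1" using ne by (intro divide_left_mono) auto
    also have "\<dots> \<le> C * exp (- (\<epsilon> * \<bar>Re u\<bar>))" using C(3)[OF u] by simp
    also have "\<dots> \<le> D * exp (- (\<epsilon> * \<bar>Re u\<bar>))" by (intro mult_right_mono) (auto simp: D_def)
    finally show ?thesis .
  qed
  then show "\<exists>C>0. \<exists>\<epsilon>>0. \<forall>u. \<bar>Im u\<bar> \<le> b \<longrightarrow> norm (?Q u) \<le> C * exp (- (\<epsilon> * \<bar>Re u\<bar>))"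
    using C(1,2) by (intro exI[of _ D] conjI exI[of _ \<epsilon>]) (auto simp: D_def)
qed

lemma strip_decay_gaussian: "strip_decay \<beta> (\<lambda>u. exp (- ((u - v)\<^sup>2 / 2)))"
  unfolding strip_decay_def
proof (intro conjI allI impI)
  show "(\<lambda>u. exp (- ((u - v)\<^sup>2 / 2))) holomorphic_on strip \<beta>" by (intro holomorphic_intros) auto
  fix b assume "b < \<beta>"
  \<comment> \<open>The 1/2 comes from |y| \<le> 1/2 + y^2/2 with y = Re (u - v), which trades the
    Gaussian for an exponential of rate 1; |Re v| recentres it at 0, and the last term bounds the
    growth due to Im (u - v).\<close>
  let ?C = "exp (1/2 + \<bar>Re v\<bar> + (b + \<bar>Im v\<bar>)\<^sup>2 / 2)"
  have "norm (exp (- ((u - v)\<^sup>2 / 2))) \<le> ?C * exp (- (1 * \<bar>Re u\<bar>))" if u: "\<bar>Im u\<bar> \<le> b" for u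
  proof -
    have 1: "(Im (u - v))\<^sup>2 \<le> (b + \<bar>Im v\<bar>)\<^sup>2"
      by (rule abs_le_square_iff[THEN iffD1]) (use u in auto)
    have 2: "\<bar>Re (u - v)\<bar> \<le> 1/2 + (Re (u - v))\<^sup>2 / 2"
      using zero_le_power2[of "\<bar>Re (u - v)\<bar> - 1"] by (simp only: power2_diff power2_abs) (simp add: field_simps)
    have 3: "\<bar>Re u\<bar> \<le> \<bar>Re (u - v)\<bar> + \<bar>Re v\<bar>" by simp
    have "Re (- ((u - v)\<^sup>2 / 2)) = - ((Re (u - v))\<^sup>2 / 2) + (Im (u - v))\<^sup>2 / 2"
      by (simp only: power2_eq_square) (simp add: field_simps)
    also have "\<dots> \<le> (1/2 + \<bar>Re v\<bar> + (b + \<bar>Im v\<bar>)\<^sup>2 / 2) + - (1 * \<bar>Re u\<bar>)"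
      using 1 2 3 by linarith
    finally show ?thesis by (simp only: norm_exp_eq_Re exp_add[symmetric] exp_le_cancel_iff)
  qed
  then show "\<exists>C>0. \<exists>\<epsilon>>0. \<forall>u. \<bar>Im u\<bar> \<le> b \<longrightarrow> norm (exp (- ((u - v)\<^sup>2 / 2))) \<le> C * exp (- (\<epsilon> * \<bar>Re u\<bar>))"
    by (intro exI[of _ ?C] conjI exI[of _ 1]) auto
qed

lemma gaussian_integral_complex:
  "(\<integral>u. exp (- ((complex_of_real u)\<^sup>2 / 2)) \<partial>lborel) = of_real (sqrt (2 * pi))"
proof -
  have "(\<integral>u. sqrt (2 * pi) * std_normal_density u \<partial>lborel) = sqrt (2 * pi)"
    by simp
  then have "(\<integral>u. exp (- (u\<^sup>2 / 2)) \<partial>lborel) = sqrt (2 * pi)"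
    by (simp add: std_normal_density_def)
  then have "complex_of_real (\<integral>u. exp (- (u\<^sup>2 / 2)) \<partial>lborel) = of_real (sqrt (2 * pi))" by simp
  then show ?thesis
    by (simp flip: of_real_power integral_complex_of_real exp_of_real add: exp_of_real[symmetric])
qed

lemma gaussian_inversion:
  "(\<integral>x. exp (- \<i> * of_real x * v) * FT (\<lambda>u. exp (- ((u - v)\<^sup>2 / 2))) x \<partial>lborel) = 2 * of_real pi"
proof -
  have FTk: "FT (\<lambda>u. exp (- ((u - v)\<^sup>2 / 2))) x = exp (\<i> * of_real x * v - (of_real x)\<^sup>2 / 2) * of_real (sqrt (2 * pi))" for x
  proof -
    \<comment> \<open>Completing the square leaves a Gaussian on the line through \<open>z\<close>
      times a factor free of \<open>u\<close>. Gaussians decay in strips of every width, so the line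
      can be moved back to the real axis however large Im z is.\<close>
    define z where "z = - v - \<i> * of_real x"
    have "exp (\<i> * of_real x * of_real u) * exp (- ((of_real u - v)\<^sup>2 / 2)) =
        exp (\<i> * of_real x * v - (of_real x)\<^sup>2 / 2) * exp (- ((of_real u + z - 0)\<^sup>2 / 2))" for u
    proof -
      have "\<i> * of_real x * of_real u + (- ((of_real u - v)\<^sup>2 / 2)) =
        (\<i> * of_real x * v - (of_real x)\<^sup>2 / 2) + (- ((of_real u + z - 0)\<^sup>2 / 2))"
        by (simp add: z_def power2_eq_square field_simps)
      then show ?thesis by (simp only: exp_add[symmetric])
    qed
    then have "FT (\<lambda>u. exp (- ((u - v)\<^sup>2 / 2))) x = 
      exp (\<i> * of_real x * v - (of_real x)\<^sup>2 / 2) * (\<integral>u. exp (- ((of_real u + z - 0)\<^sup>2 / 2)) \<partial>lborel)"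
      unfolding FT_def by (simp only: integral_mult_right_zero)
    also have "(\<integral>u. exp (- ((of_real u + z - 0)\<^sup>2 / 2)) \<partial>lborel) = (\<integral>u. exp (- ((of_real u - 0)\<^sup>2 / 2)) \<partial>lborel)"
      by (rule strip_decay_shift[OF strip_decay_gaussian[of "\<bar>Im z\<bar> + 1"]]) simp
    finally show ?thesis using gaussian_integral_complex by simp
  qed
  \<comment> \<open>The transform of the Gaussian is again Gaussian; one factor sqrt (2 pi) from
    each integral makes up the 2 pi of the inversion formula.\<close>
  have "exp (- \<i> * of_real x * v) * FT (\<lambda>u. exp (- ((u - v)\<^sup>2 / 2))) x =
     exp (- ((of_real x)\<^sup>2 / 2)) * of_real (sqrt (2 * pi))" for x
    unfolding FTk mult.assoc[symmetric] exp_add[symmetric] by simp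
  then have "(\<integral>x. exp (- \<i> * of_real x * v) * FT (\<lambda>u. exp (- ((u - v)\<^sup>2 / 2))) x \<partial>lborel) =
     of_real (sqrt (2 * pi)) * of_real (sqrt (2 * pi))"
    by (simp only: integral_mult_left_zero gaussian_integral_complex)
  also have "\<dots> = of_real (sqrt (2 * pi) * sqrt (2 * pi))" by (simp only: of_real_mult)
  also have "\<dots> = 2 * of_real pi" by simp
  finally show ?thesis .
qed

text \<open>
  Subtracting a multiple of a Gaussian centred at \<open>v\<close> reduces the inversion formula to the case
  \<open>H v = 0\<close>, in which \<open>H u = (u - v) * Q u\<close> and the integrand is a total derivative.
\<close>
theorem FT_inversion:
  assumes H: "strip_decay \<beta> H" and v: "\<bar>Im v\<bar> < \<beta>"
  shows "has_bochner_integral lborel (\<lambda>x. exp (- \<i> * of_real x * v) * FT H x) (2 * of_real pi * H v)"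
proof -
  let ?k = "\<lambda>u. H v * exp (- ((u - v)\<^sup>2 / 2))"
  have k: "strip_decay \<beta> ?k" by (rule strip_decay_cmult[OF strip_decay_gaussian])
  have \<beta>: "\<beta> > 0" using v by auto
  let ?D = "\<lambda>u. H u - ?k u"
  have D: "strip_decay \<beta> ?D" by (rule strip_decay_diff[OF H k])
  define Q where "Q = (\<lambda>u. if u = v then deriv ?D v else ?D u / (u - v))"
  have Q: "strip_decay \<beta> Q" unfolding Q_def by (rule strip_decay_quotient[OF D v]) simp
  have DQ: "?D = (\<lambda>u. (u - v) * Q u)" by (auto simp: Q_def)
  have "(\<integral>x. exp (- \<i> * of_real x * v) * FT ?D x \<partial>lborel) = 0"
    using FT_inversion_zero[OF Q _ v] D unfolding DQ by blast
  moreover have "exp (- \<i> * of_real x * v) * FT ?D x =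
     exp (- \<i> * of_real x * v) * FT H x - exp (- \<i> * of_real x * v) * FT ?k x" for x
    by (simp only: FT_diff[OF H k \<beta>] right_diff_distrib)
  moreover have "(\<integral>x. exp (- \<i> * of_real x * v) * FT ?k x \<partial>lborel) = 2 * of_real pi * H v"
  proof -
    have "exp (- \<i> * of_real x * v) * FT ?k x = 
        H v * (exp (- \<i> * of_real x * v) * FT (\<lambda>u. exp (- ((u - v)\<^sup>2 / 2))) x)" for x
      by (simp only: FT_cmult mult_ac)
    then show ?thesis by (simp only: integral_mult_right_zero gaussian_inversion) simp
  qed
  ultimately have "(\<integral>x. exp (- \<i> * of_real x * v) * FT H x \<partial>lborel) = 2 * of_real pi * H v"
    using FT_weighted_integrable[OF H v] FT_weighted_integrable[OF k v]
    by (simp only: Bochner_Integration.integral_diff) simp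
  with FT_weighted_integrable[OF H v] show ?thesis by (simp add: has_bochner_integral_iff)
qed

section \<open>The Beta kernel and its Fourier transform\<close>

text \<open>With t = e^u / (1 + e^u) this is t^a (1 - t)^b, and du = dt / (t (1 - t)). As a single
  exponential it is holomorphic wherever \<open>Ln (1 + exp u)\<close> is, and changes of the
  exponents become additive.\<close>

definition hker :: "real \<Rightarrow> real \<Rightarrow> complex \<Rightarrow> complex" where
  "hker a b u = exp (of_real a * u - of_real (a + b) * Ln (1 + exp u))"

lemma one_plus_exp_nonpos:
  assumes "u \<in> strip pi"
  shows "1 + exp u \<notin> \<real>\<^sub>\<le>\<^sub>0"
proof
  assume "1 + exp u \<in> \<real>\<^sub>\<le>\<^sub>0"
  then have *: "1 + exp (Re u) * cos (Im u) \<le> 0" "exp (Re u) * sin (Im u) = 0"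
    by (auto simp: complex_nonpos_Reals_iff Re_exp Im_exp)
  from *(2) have "sin (Im u) = 0" by simp
  then have "Im u = 0" using assms sin_eq_0_pi[of "Im u"] by (simp add: abs_less_iff)
  with *(1) show False using exp_gt_zero[of "Re u"] by (simp del: exp_gt_zero)
qed

lemma hker_holomorphic: "hker a b holomorphic_on strip pi"
  unfolding hker_def[abs_def]
  by (intro holomorphic_intros) (use one_plus_exp_nonpos in auto)

text \<open>With r = exp (Re u) and c = cos (Im u / 2), the squared modulus is (1 - r)^2 + 4 c^2 r,
  which is at least c^2 (1 + r)^2 because c^2 \<le> 1. The cosine measures the distance from the
  zeros of 1 + e^u on the edge of the strip.\<close>

lemma norm_one_plus_exp_ge:
  assumes "\<bar>Im u\<bar> \<le> b" "b < pi"
  shows "norm (1 + exp u) \<ge> cos (b / 2) * (1 + exp (Re u))"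
proof -
  define c where "c = cos (Im u / 2)"
  have "cos (b / 2) \<le> cos (\<bar>Im u\<bar> / 2)" using assms by (intro cos_monotone_0_pi_le) auto
  also have "\<dots> = c" by (auto simp: c_def abs_if)
  finally have cb: "cos (b / 2) \<le> c" .
  have "c\<^sup>2 \<le> 1" by (simp add: c_def abs_square_le_1)
  have cy: "cos (Im u) = 2 * c\<^sup>2 - 1"
    using cos_double_cos[of "Im u / 2"] by (simp add: c_def)
  have "(norm (1 + exp u))\<^sup>2 = (1 + exp (Re u) * cos (Im u))\<^sup>2 + (exp (Re u) * sin (Im u))\<^sup>2"
    by (simp add: cmod_power2 Re_exp Im_exp)
  also have "\<dots> = 1 + 2 * exp (Re u) * cos (Im u) + (exp (Re u))\<^sup>2 * ((sin (Im u))\<^sup>2 + (cos (Im u))\<^sup>2)"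
    by (simp add: power2_sum power_mult_distrib distrib_left del: sin_cos_squared_add sin_cos_squared_add2)
  also have "\<dots> = 1 + 2 * exp (Re u) * cos (Im u) + (exp (Re u))\<^sup>2" by simp
  also have "\<dots> = (1 - exp (Re u))\<^sup>2 + c\<^sup>2 * (4 * exp (Re u))"
    by (simp add: cy power2_eq_square algebra_simps)
  also have "\<dots> \<ge> c\<^sup>2 * (1 - exp (Re u))\<^sup>2 + c\<^sup>2 * (4 * exp (Re u))"
    using mult_right_mono[OF \<open>c\<^sup>2 \<le> 1\<close>, of "(1 - exp (Re u))\<^sup>2"] by simp
  also have "c\<^sup>2 * (1 - exp (Re u))\<^sup>2 + c\<^sup>2 * (4 * exp (Re u)) = (c * (1 + exp (Re u)))\<^sup>2"
    by (simp add: power2_eq_square algebra_simps)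
  finally have "c * (1 + exp (Re u)) \<le> norm (1 + exp u)"
    by (rule power2_le_imp_le) simp
  moreover have "cos (b / 2) * (1 + exp (Re u)) \<le> c * (1 + exp (Re u))"
    using cb by (intro mult_right_mono) (auto intro: add_nonneg_nonneg)
  ultimately show ?thesis by linarith
qed

text \<open>Since ln (1 + e^x) is at least max 0 x, the kernel decays like exp (a Re u) to the left
  and exp (- b Re u) to the right; \<open>min a b\<close> serves both sides. The constant is the
  loss from \<open>norm_one_plus_exp_ge\<close> off the real axis.\<close>

lemma norm_hker_bound:
  assumes ab: "a > 0" "b > 0" and u: "\<bar>Im u\<bar> \<le> y" "y < pi"
  shows "norm (hker a b u) \<le> exp (- (a + b) * ln (cos (y / 2))) * exp (- (min a b * \<bar>Re u\<bar>))"
proof -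
  have y0: "y \<ge> 0" using u by linarith
  have c: "cos (y / 2) > 0" using u y0 by (intro cos_gt_zero_pi) auto
  have e: "1 + exp (Re u) > 0" by (intro add_pos_pos) auto
  have *: "norm (1 + exp u) \<ge> cos (y / 2) * (1 + exp (Re u))" by (rule norm_one_plus_exp_ge[OF u])
  moreover have pos: "cos (y / 2) * (1 + exp (Re u)) > 0" using c e by simp
  ultimately have n0: "norm (1 + exp u) > 0" by linarith
  have "ln (cos (y / 2)) + ln (1 + exp (Re u)) \<le> ln (norm (1 + exp u))"
    using * pos n0 c e by (subst ln_mult_pos[symmetric]) auto
  moreover have "max 0 (Re u) \<le> ln (1 + exp (Re u))"
  proof (rule max.boundedI)
    show "0 \<le> ln (1 + exp (Re u))" by simp
    show "Re u \<le> ln (1 + exp (Re u))" using e by (simp add: ln_ge_iff)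
  qed
  ultimately have "ln (cos (y / 2)) + max 0 (Re u) \<le> ln (norm (1 + exp u))" by linarith
  then have "(a + b) * (ln (cos (y / 2)) + max 0 (Re u)) \<le> (a + b) * ln (norm (1 + exp u))"
    by (rule mult_left_mono) (use ab in simp)
  moreover have "a * Re u - (a + b) * max 0 (Re u) \<le> - (min a b * \<bar>Re u\<bar>)"
  proof (cases "Re u \<ge> 0")
    case True
    then have "min a b * Re u \<le> b * Re u" by (intro mult_right_mono) auto
    with True show ?thesis by (simp add: algebra_simps)
  next
    case False
    then have "a * Re u \<le> min a b * Re u" by (intro mult_right_mono_neg) auto
    with False show ?thesis by (simp add: algebra_simps)
  qed
  ultimately have "a * Re u - (a + b) * ln (norm (1 + exp u)) \<le> - (a + b) * ln (cos (y / 2)) + - (min a b * \<bar>Re u\<bar>)"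
    by (simp add: algebra_simps)
  moreover have "norm (hker a b u) = exp (a * Re u - (a + b) * ln (norm (1 + exp u)))"
    using n0 by (simp add: hker_def Re_Ln)
  ultimately show ?thesis by (simp only: exp_add[symmetric] exp_le_cancel_iff)
qed

lemma strip_decay_hker:
  assumes "a > 0" "b > 0"
  shows "strip_decay pi (hker a b)"
  unfolding strip_decay_def
proof (intro conjI allI impI)
  fix y :: real assume "y < pi"
  then have "\<forall>u. \<bar>Im u\<bar> \<le> y \<longrightarrow>
      norm (hker a b u) \<le> exp (- (a + b) * ln (cos (y / 2))) * exp (- (min a b * \<bar>Re u\<bar>))"
    using norm_hker_bound[OF assms] by blast
  moreover have "min a b > 0" using assms by simp
  ultimately show "\<exists>C>0. \<exists>\<epsilon>>0. \<forall>u. \<bar>Im u\<bar> \<le> y \<longrightarrow> norm (hker a b u) \<le> C * exp (- (\<epsilon> * \<bar>Re u\<bar>))"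
    using exp_gt_zero by blast
qed (rule hker_holomorphic)

lemma hker_of_real:
  "hker a b (of_real u) = of_real (exp (a * u) * (1 + exp u) powr (- (a + b)))"
proof -
  have pos: "1 + exp u > 0" by (intro add_pos_pos) auto
  have "1 + exp (complex_of_real u) = of_real (1 + exp u)" by (simp add: exp_of_real)
  then have "Ln (1 + exp (complex_of_real u)) = of_real (ln (1 + exp u))"
    using pos by (simp only: Ln_of_real)
  then have "hker a b (of_real u) = exp (of_real (a * u + - (a + b) * ln (1 + exp u)))"
    by (simp add: hker_def algebra_simps)
  also have "\<dots> = of_real (exp (a * u + - (a + b) * ln (1 + exp u)))" by (simp only: exp_of_real)
  also have "\<dots> = of_real (exp (a * u) * (1 + exp u) powr (- (a + b)))"
    unfolding exp_add using pos by (simp add: powr_def)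
  finally show ?thesis .
qed

lemma Beta_integral_line:
  assumes a: "a > 0" and b: "b > 0"
  shows "(\<integral>u. exp (a * u) * (1 + exp u) powr (- (a + b)) \<partial>lborel) = Beta a (b :: real)"
proof -
  let ?f = "\<lambda>t::real. t powr (a - 1) * (1 - t) powr (b - 1)"
  \<comment> \<open>The logistic substitution for t; its derivative t (1 - t) raises both exponents
    of \<open>?f\<close> by one.\<close>
  let ?g = "\<lambda>u::real. 1 / (1 + exp (- u))"
  let ?g' = "\<lambda>u::real. exp (- u) / (1 + exp (- u))\<^sup>2"
  have pos: "1 + exp u > 0" for u :: real by (intro add_pos_pos) auto
  have img: "range ?g = {0<..<1}"
  proof (intro equalityI subsetI)
    fix t assume "t \<in> range ?g"
    then show "t \<in> {0<..<1}" using pos by (auto simp: field_simps)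
  next
    fix t :: real assume t: "t \<in> {0<..<1}"
    then have "t = ?g (- ln ((1 - t) / t))" by (simp add: field_simps)
    then show "t \<in> range ?g" by blast
  qed
  have "?f absolutely_integrable_on {0<..<1}" "integral {0<..<1} ?f = Beta a b"
  proof -
    have "(?f has_integral Beta a b) {0<..<1}"
      using has_integral_Beta_real[OF a b] by (simp add: has_integral_Icc_iff_Ioo)
    then show "integral {0<..<1} ?f = Beta a b" "?f absolutely_integrable_on {0<..<1}"
      by (auto simp: absolutely_integrable_on_iff_nonneg)
  qed
  then have "integral UNIV (\<lambda>u. \<bar>?g' u\<bar> * ?f (?g u)) = Beta a b"
  proof -
    have "(?g has_field_derivative ?g' x) (at x within UNIV)" for x
      using pos[of "-x"] by (auto intro!: derivative_eq_intros simp: power2_eq_square)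
    moreover have "inj ?g" using pos by (auto intro!: injI simp: field_simps)
    ultimately show ?thesis
      using has_absolute_integral_change_of_variables_1'[of UNIV ?g ?g' ?f "Beta a b"] img
        \<open>?f absolutely_integrable_on {0<..<1}\<close> \<open>integral {0<..<1} ?f = Beta a b\<close> by simp
  qed
  moreover have "\<bar>?g' u\<bar> * ?f (?g u) = exp (a * u) * (1 + exp u) powr (- (a + b))" for u
  proof -
    \<comment> \<open>All factors become exponentials of linear expressions in \<open>u\<close> and
      \<open>L\<close>, which reduces the identity of real powers to linear arithmetic in the
      exponent.\<close>
    define L where "L = ln (1 + exp (- u))"
    have L: "1 + exp (- u) = exp L" using pos[of "-u"] by (simp add: L_def)
    have "1 + exp u = exp u * (1 + exp (- u))" by (simp add: algebra_simps flip: exp_add)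
    then have L2: "1 + exp u = exp (u + L)" by (simp add: L exp_add)
    have 1: "?g u = exp (- L)" unfolding L by (simp add: exp_minus inverse_eq_divide)
    have "1 - ?g u = exp (- u) / (1 + exp (- u))" using pos[of "-u"] by (simp add: field_simps)
    then have 2: "1 - exp (- L) = exp (- u - L)" unfolding 1 by (simp only: L exp_diff)
    have 3: "?g' u = exp (- u - 2 * L)" by (simp add: L exp_diff power2_eq_square flip: exp_add)
    show ?thesis unfolding 1 2 3 L2 powr_def by (simp add: algebra_simps flip: exp_add)
  qed
  ultimately have "integral UNIV (\<lambda>u. exp (a * u) * (1 + exp u) powr (- (a + b))) = Beta a b" by simp
  \<comment> \<open>The change of variables yields the gauge integral over \<open>UNIV\<close>; it
    agrees with the integral over \<open>lborel\<close> once integrability is known, here from the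
    decay of \<open>hker\<close>.\<close>
  moreover have "integrable lborel (\<lambda>u. exp (a * u) * (1 + exp u) powr (- (a + b)))"
  proof -
    have "integrable lborel (\<lambda>u::real. hker a b (of_real u))"
      using strip_decay_integrable[OF strip_decay_hker[OF a b], of 0] by simp
    then show ?thesis unfolding hker_of_real complex_of_real_integrable_eq .
  qed
  ultimately show ?thesis using integral_lborel by metis
qed

lemma Gamma_right_half_plane: "Re z > 0 \<Longrightarrow> z \<notin> \<int>\<^sub>\<le>\<^sub>0"
  by (auto elim!: nonpos_Ints_cases)

lemma hker_exp_real:
  "exp (of_real s * of_real u) * hker a b (of_real u) = hker (a + s) (b - s) (of_real u)"
  unfolding hker_def by (simp add: algebra_simps flip: exp_add)

text \<open>For real \<open>z\<close> the exponential merely changes the exponents to a + z and b -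
  z, and the value is a real Beta integral. Both sides are holomorphic in the vertical strip, so the
  identity theorem extends the equation to complex \<open>z\<close>.\<close>

lemma hker_Beta_complex:
  assumes z: "- a < Re z" "Re z < b"
  shows "(\<integral>u. exp (z * of_real u) * hker a b (of_real u) \<partial>lborel) =
           Gamma (of_real a + z) * Gamma (of_real b - z) / of_real (Gamma (a + b))"
proof -
  define S where "S = {z::complex. - a < Re z \<and> Re z < b}"
  define L where "L = (\<lambda>z. \<integral>u. exp (z * of_real u) * hker a b (of_real u) \<partial>lborel)"
  define R where "R = (\<lambda>z. Gamma (of_real a + z) * Gamma (of_real b - z) / complex_of_real (Gamma (a + b)))"
  have S_eq: "S = {z. - a < Re z} \<inter> {z. Re z < b}" by (auto simp: S_def)
  have S: "open S" "connected S"
    unfolding S_eq by (auto intro!: open_Int open_halfspace_Re_lt open_halfspace_Re_gt convex_connected convex_Int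
         convex_halfspace_Re_lt convex_halfspace_Re_gt)
  have int: "integrable lborel (\<lambda>u. norm (exp (of_real s * of_real u) * hker a b (complex_of_real u)))"
    if s: "- a < s" "s < b" for s
    unfolding hker_exp_real
    using strip_decay_integrable[OF strip_decay_hker[of "a + s" "b - s"], of 0] s by simp
  have meas: "(\<lambda>u. hker a b (complex_of_real u)) \<in> borel_measurable lborel"
  proof -
    have "continuous_on UNIV (\<lambda>u. hker a b (complex_of_real u))"
      by (rule continuous_on_compose2[OF holomorphic_on_imp_continuous_on[OF hker_holomorphic]])
         (auto intro!: continuous_intros)
    then show ?thesis by (simp add: borel_measurable_continuous_onI)
  qed
  have holL: "L holomorphic_on S"
    unfolding L_def
  proof (rule holomorphic_integral_param(1)[OF S(1)])
    show "(\<lambda>u. exp (z * of_real u) * hker a b (of_real u)) \<in> borel_measurable lborel" for z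
      using meas by (intro borel_measurable_times) simp_all
    show "(\<lambda>z. exp (z * of_real t) * hker a b (of_real t)) holomorphic_on S" for t
      by (intro holomorphic_intros)
    fix z0 assume z0: "z0 \<in> S"
    \<comment> \<open>Half the distance to the nearer edge. For z in this ball |exp (z t)| is at
      most the sum of the real exponentials with rates Re z0 + r and Re z0 - r, each of which covers
      one sign of \<open>t\<close>.\<close>
    define r where "r = min (Re z0 + a) (b - Re z0) / 2"
    have r: "r > 0" "- a < Re z0 - r" "Re z0 + r < b"
      using z0 by (auto simp: r_def S_def min_def field_simps)
    let ?G = "\<lambda>u. norm (exp (of_real (Re z0 + r) * of_real u) * hker a b (complex_of_real u)) +
        norm (exp (of_real (Re z0 - r) * of_real u) * hker a b (complex_of_real u))"
    have "integrable lborel ?G" using r by (intro Bochner_Integration.integrable_add int) auto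
    moreover have "norm (exp (z * of_real t) * hker a b (of_real t)) \<le> ?G t" if "z \<in> ball z0 r" for z t
    proof -
      have re: "\<bar>Re z - Re z0\<bar> < r"
        using that abs_Re_le_cmod[of "z - z0"] by (simp add: dist_norm norm_minus_commute)
      have "exp (Re z * t) \<le> exp ((Re z0 + r) * t) + exp ((Re z0 - r) * t)"
      proof (cases "t \<ge> 0")
        case True
        then have "Re z * t \<le> (Re z0 + r) * t" using re by (intro mult_right_mono) auto
        then have "exp (Re z * t) \<le> exp ((Re z0 + r) * t)" by simp
        then show ?thesis using exp_ge_zero[of "(Re z0 - r) * t"] by linarith
      next
        case False
        then have "Re z * t \<le> (Re z0 - r) * t" using re by (intro mult_right_mono_neg) auto
        then have "exp (Re z * t) \<le> exp ((Re z0 - r) * t)" by simp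
        then show ?thesis using exp_ge_zero[of "(Re z0 + r) * t"] by linarith
      qed
      then show ?thesis
        unfolding norm_mult distrib_right[symmetric] by (intro mult_right_mono) simp_all
    qed
    ultimately show "\<exists>r>0. \<exists>G. integrable lborel G \<and>
        (\<forall>z\<in>ball z0 r \<inter> S. \<forall>t. norm (exp (z * of_real t) * hker a b (of_real t)) \<le> G t)"
      using r(1) by blast
  qed
  have holR: "R holomorphic_on S"
    unfolding R_def
  proof (intro holomorphic_intros)
    fix z assume "z \<in> S"
    then show "of_real a + z \<notin> \<int>\<^sub>\<le>\<^sub>0" "of_real b - z \<notin> \<int>\<^sub>\<le>\<^sub>0"
      by (auto intro!: Gamma_right_half_plane simp: S_def)
  next
    show "complex_of_real (Gamma (a + b)) \<noteq> 0" 
    proof -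
      have "a + b > 0" using z by linarith
      from Gamma_real_pos[OF this] show ?thesis by simp
    qed
  qed
  define r0 where "r0 = (b - a) / 2"
  have real_eq: "L (of_real s) = R (of_real s)" if s: "- a < s" "s < b" for s
  proof -
    have "L (of_real s) = (\<integral>u. hker (a + s) (b - s) (of_real u) \<partial>lborel)"
      unfolding L_def hker_exp_real ..
    also have "\<dots> = of_real (Beta (a + s) (b - s))"
      unfolding hker_of_real integral_complex_of_real by (subst Beta_integral_line) (use s in auto)
    also have "\<dots> = R (of_real s)"
      by (simp add: Beta_def R_def flip: Gamma_complex_of_real)
    finally show ?thesis .
  qed
  have "L z - R z = 0"
  proof (rule analytic_continuation[of "\<lambda>z. L z - R z" S "of_real ` {-a<..<b}" "of_real r0"])
    show "(\<lambda>z. L z - R z) holomorphic_on S" by (intro holomorphic_intros holL holR)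
    show "complex_of_real r0 islimpt of_real ` {-a<..<b}"
    proof -
      have "r0 islimpt {-a<..<b}" using z by (intro open_imp_islimpt) (auto simp: r0_def)
      then show ?thesis
        unfolding islimpt_sequential using tendsto_of_real
        by (metis (mono_tags, lifting) DiffE DiffI image_eqI of_real_eq_iff singleton_iff)
    qed
  qed (use S z real_eq in \<open>auto simp: S_def r0_def\<close>)
  then show ?thesis by (simp add: L_def R_def)
qed

lemma FT_hker:
  assumes "a > 0" "b > 0"
  shows "FT (hker a b) x = Gamma (of_real a + \<i> * of_real x) * Gamma (of_real b - \<i> * of_real x) / of_real (Gamma (a + b))"
  unfolding FT_def using assms by (intro hker_Beta_complex) auto

section \<open>Binomial series and Euler's integral\<close>

lemma binomial_series_sums:
  fixes w \<gamma> :: complex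
  assumes "norm w < 1"
  shows "(\<lambda>n. pochhammer \<gamma> n / fact n * w ^ n) sums (1 - w) powr (- \<gamma>)"
proof -
  have "(\<lambda>n. (- \<gamma> gchoose n) * (- w) ^ n) sums (1 + - w) powr (- \<gamma>)"
    by (rule gen_binomial_complex) (use assms in simp)
  moreover have "(- \<gamma> gchoose n) * (- w) ^ n = pochhammer \<gamma> n / fact n * w ^ n" for n
  proof -
    have "(- w) ^ n = (-1) ^ n * w ^ n" by (rule power_minus)
    then show ?thesis by (simp add: gbinomial_pochhammer mult_ac flip: power_mult_distrib)
  qed
  ultimately show ?thesis by simp
qed

lemma binomial_series_abs_summable:
  fixes \<gamma> :: complex
  assumes "0 \<le> r" "r < 1"
  shows "summable (\<lambda>n. norm (pochhammer \<gamma> n / fact n) * r ^ n)"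
proof -
  let ?x = "complex_of_real ((1 + r) / 2)"
  have "norm ?x < 1" using assms by (simp only: norm_of_real) simp
  then have "summable (\<lambda>n. pochhammer \<gamma> n / fact n * ?x ^ n)"
    by (rule sums_summable[OF binomial_series_sums])
  moreover have "norm (complex_of_real r) < norm ?x" using assms by (simp only: norm_of_real) simp
  ultimately have "summable (\<lambda>n. norm (pochhammer \<gamma> n / fact n * of_real r ^ n))"
    by (rule powser_insidea)
  then show ?thesis using assms by (simp add: norm_mult norm_power norm_divide)
qed

text \<open>A bound that separates the index from the variable makes the series absolutely summable
  both pointwise and in L1, as the exchange of sum and integral requires. It serves the integrals
  over \<open>u\<close> and the final one over \<open>x\<close>.\<close>

lemma
  fixes f :: "nat \<Rightarrow> 'a \<Rightarrow> complex"
  assumes int: "\<And>n. integrable M (f n)"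
    and le: "\<And>n x. norm (f n x) \<le> s n * G x"
    and s: "summable s" and G: "integrable M G"
    and F: "\<And>x. (\<lambda>n. f n x) sums F x"
  shows integrable_dominated_sums: "integrable M F"
    and integral_dominated_sums: "(\<lambda>n. integral\<^sup>L M (f n)) sums integral\<^sup>L M F"
proof -
  have AE: "AE x in M. summable (\<lambda>n. norm (f n x))"
    by (intro always_eventually allI summable_comparison_test'[OF summable_mult2[OF s], of 0])
       (use le in auto)
  have S: "summable (\<lambda>n. \<integral>x. norm (f n x) \<partial>M)"
  proof (rule summable_comparison_test'[OF summable_mult2[OF s, of "\<integral>x. G x \<partial>M"], of 0])
    fix n
    have "(\<integral>x. norm (f n x) \<partial>M) \<le> (\<integral>x. s n * G x \<partial>M)"
      by (rule integral_mono) (use int G le in auto)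
    then show "norm (\<integral>x. norm (f n x) \<partial>M) \<le> s n * (\<integral>x. G x \<partial>M)" by simp
  qed
  have F': "F = (\<lambda>x. \<Sum>n. f n x)" using F by (auto simp: sums_iff)
  show "integrable M F" unfolding F' by (rule integrable_suminf[OF int AE S])
  show "(\<lambda>n. integral\<^sup>L M (f n)) sums integral\<^sup>L M F"
    unfolding F' by (rule sums_integral[OF int AE S])
qed

text \<open>The multiplier \<open>m\<close> is left general because two are inserted: t in Euler's
  integral, and the pencil in the expansion in \<rho>.\<close>

lemma binomial_series_integral:
  fixes H m :: "'a \<Rightarrow> complex"
  assumes H: "integrable M H" and m [measurable]: "m \<in> borel_measurable M"
    and m1: "\<And>u. norm (m u) \<le> 1" and \<rho>: "norm \<rho> < 1"
  shows "(\<lambda>n. pochhammer \<gamma> n / fact n * \<rho> ^ n * (\<integral>u. H u * m u ^ n \<partial>M)) sums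
           (\<integral>u. H u * (1 - \<rho> * m u) powr (- \<gamma>) \<partial>M)"
proof -
  have Hm [measurable]: "H \<in> borel_measurable M" using H by (rule borel_measurable_integrable)
  let ?c = "\<lambda>n. pochhammer \<gamma> n / fact n * \<rho> ^ n"
  have c: "summable (\<lambda>n. norm (?c n))"
    using binomial_series_abs_summable[of "norm \<rho>" \<gamma>] \<rho> by (simp only: norm_mult norm_power) simp
  let ?f = "\<lambda>n u. ?c n * (H u * m u ^ n)"
  have le: "norm (H u * m u ^ n) \<le> norm (H u)" for u n
    using mult_left_mono[OF power_le_one[OF norm_ge_zero m1[of u], of n], of "norm (H u)"]
    by (simp add: norm_mult norm_power)
  have "integrable M (\<lambda>u. H u * m u ^ n)" for n
    by (rule Bochner_Integration.integrable_bound[OF H]) (use le in auto)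
  then have int: "integrable M (?f n)" for n by (intro integrable_mult_right)
  have le2: "norm (?f n u) \<le> norm (?c n) * norm (H u)" for n u
    unfolding norm_mult[of "?c n"] by (rule mult_left_mono[OF le]) simp
  have "(\<lambda>n. ?f n u) sums (H u * (1 - \<rho> * m u) powr (- \<gamma>))" for u
  proof -
    have "norm (\<rho> * m u) < 1"
      using mult_left_mono[OF m1[of u], of "norm \<rho>"] \<rho> by (simp add: norm_mult)
    from sums_mult[OF binomial_series_sums[OF this, of \<gamma>], of "H u"]
    show ?thesis by (simp add: power_mult_distrib mult_ac)
  qed
  from integral_dominated_sums[OF int le2 c integrable_norm[OF H] this]
  show ?thesis by simp
qed

section \<open>Analytic continuation of the hypergeometric series\<close>

lemma hyp2F1_cut_iff: "z \<in> hyp2F1_cut \<longleftrightarrow> Im z = 0 \<and> Re z \<ge> 1"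
proof
  assume "Im z = 0 \<and> Re z \<ge> 1"
  then have "z = of_real (Re z)" "Re z \<in> {1..}" by (auto simp: complex_eq_iff)
  then show "z \<in> hyp2F1_cut" unfolding hyp2F1_cut_def by (rule image_eqI)
qed (auto simp: hyp2F1_cut_def)

lemma closed_hyp2F1_cut: "closed hyp2F1_cut"
proof -
  have eq: "hyp2F1_cut = {z. Im z \<le> 0} \<inter> {z. Im z \<ge> 0} \<inter> {z. Re z \<ge> 1}"
    by (auto simp: hyp2F1_cut_iff)
  show ?thesis unfolding eq
    by (intro closed_Int closed_halfspace_Im_le closed_halfspace_Im_ge closed_halfspace_Re_ge)
qed

lemma connected_hyp2F1_domain: "connected (- hyp2F1_cut)"
proof (rule starlike_imp_connected)
  show "starlike (- hyp2F1_cut)"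
    unfolding starlike_def
  proof (intro bexI ballI subsetI)
    show "0 \<in> - hyp2F1_cut" by (simp add: hyp2F1_cut_iff)
    fix z x assume z: "z \<in> - hyp2F1_cut" and x: "x \<in> closed_segment 0 z"
    then obtain t where t: "0 \<le> t" "t \<le> 1" "x = of_real t * z"
      by (auto simp: in_segment scaleR_conv_of_real)
    show "x \<in> - hyp2F1_cut"
    proof
      assume "x \<in> hyp2F1_cut"
      then have *: "t * Im z = 0" "t * Re z \<ge> 1" using t by (auto simp: hyp2F1_cut_iff)
      then have "t > 0" using t by (cases "t = 0") auto
      with * have "Im z = 0" "Re z \<ge> 0" 
        by (auto simp: zero_le_mult_iff intro: ccontr dest: order.trans[OF zero_le_one])
      moreover have "t * Re z \<le> 1 * Re z" using t \<open>Re z \<ge> 0\<close> by (intro mult_right_mono) auto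
      ultimately show False using z * by (auto simp: hyp2F1_cut_iff)
    qed
  qed
qed

text \<open>By the identity theorem on the connected slit plane every holomorphic extension is the
  one that \<open>THE\<close> selects, so evaluating \<open>hyp2F1\<close> reduces to exhibiting
  some extension.\<close>

lemma hyp2F1_eqI:
  assumes F: "F holomorphic_on (- hyp2F1_cut)"
    and ser: "\<And>u. norm u < 1 \<Longrightarrow> F u = hyp2F1_series a b c u" and z: "z \<notin> hyp2F1_cut"
  shows "hyp2F1 a b c z = F z"
proof -
  have "(THE w. \<exists>F. F holomorphic_on (- hyp2F1_cut) \<and>
          (\<forall>u. norm u < 1 \<longrightarrow> F u = hyp2F1_series a b c u) \<and> F z = w) = F z"
  proof (rule the_equality)
    fix w assume "\<exists>F. F holomorphic_on (- hyp2F1_cut) \<and>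
          (\<forall>u. norm u < 1 \<longrightarrow> F u = hyp2F1_series a b c u) \<and> F z = w"
    then obtain G where G: "G holomorphic_on (- hyp2F1_cut)"
      "\<And>u. norm u < 1 \<Longrightarrow> G u = hyp2F1_series a b c u" "G z = w" by blast
    have "G z = F z"
    proof (rule analytic_continuation_open[of "ball 0 1" "- hyp2F1_cut" G F z])
      show "ball 0 1 \<subseteq> - hyp2F1_cut"
        by (auto simp: hyp2F1_cut_def norm_of_real)
    qed (use closed_hyp2F1_cut connected_hyp2F1_domain G F ser z in \<open>auto simp: open_Compl\<close>)
    with G show "w = F z" by simp
  qed (use assms in blast)
  with z show ?thesis by (simp add: hyp2F1_def)
qed

text \<open>Otherwise z t would be real and at least 1, hence z real and at least 1/t \<ge> 1. This
  keeps the principal power in Euler's integral holomorphic in \<open>z\<close>.\<close>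

lemma hyp2F1_kernel_slit:
  assumes z: "z \<notin> hyp2F1_cut" and t: "0 \<le> t" "t \<le> 1"
  shows "1 - z * of_real t \<notin> \<real>\<^sub>\<le>\<^sub>0"
proof
  assume "1 - z * of_real t \<in> \<real>\<^sub>\<le>\<^sub>0"
  then have *: "Re z * t \<ge> 1" "Im z * t = 0" by (auto simp: complex_nonpos_Reals_iff)
  then have t0: "t > 0" using t by (cases "t = 0") auto
  with * have "Im z = 0" by simp
  moreover have "Re z \<ge> 1"
  proof (rule ccontr)
    assume "\<not> Re z \<ge> 1"
    then have "Re z * t < 1 * t" using t0 by (intro mult_strict_right_mono) auto
    with * t show False by simp
  qed
  ultimately show False using z by (simp add: hyp2F1_cut_iff)
qed

text \<open>The factor is a power of t, so only the first exponent grows;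
  \<open>hker_mult_right\<close> treats 1 - t and the second exponent.\<close>

lemma hker_mult_left:
  assumes "u \<in> strip pi"
  shows "hker a b u * (exp u / (1 + exp u)) ^ n = hker (a + real n) b u"
proof -
  have "1 + exp u \<noteq> 0" using one_plus_exp_nonpos[OF assms] by auto
  then have "exp u / (1 + exp u) = exp (u - Ln (1 + exp u))" by (simp add: exp_diff)
  then have "(exp u / (1 + exp u)) ^ n = exp (of_nat n * (u - Ln (1 + exp u)))"
    by (simp add: exp_of_nat_mult)
  then show ?thesis by (simp add: hker_def algebra_simps flip: exp_add)
qed

lemma hker_mult_right:
  assumes "u \<in> strip pi"
  shows "hker a b u * (1 / (1 + exp u)) ^ n = hker a (b + real n) u"
proof -
  have "1 + exp u \<noteq> 0" using one_plus_exp_nonpos[OF assms] by auto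
  then have "1 / (1 + exp u) = exp (- Ln (1 + exp u))" by (simp add: exp_minus field_simps)
  then have "(1 / (1 + exp u)) ^ n = exp (of_nat n * (- Ln (1 + exp u)))"
    by (simp only: exp_of_nat_mult)
  then show ?thesis by (simp add: hker_def algebra_simps flip: exp_add)
qed

lemma FT_hker_integrable:
  assumes "a > 0" "b > 0"
  shows "integrable lborel (\<lambda>u. exp (\<i> * of_real x * of_real u) * hker a b (complex_of_real u))"
  using FT_integrable[OF strip_decay_hker[OF assms]] by simp

text \<open>The integral is holomorphic on the slit plane. In the unit disc it expands in powers of
  \<open>z\<close>; the n-th moment of t is the transform of \<open>hker (a + n) b\<close>, whose
  Gamma quotient supplies the Pochhammer ratio. The complementary parameter is b - i x, so for a = b
  the Gamma product is |Gamma (a + i x)|^2.\<close>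

theorem hyp2F1_Euler_integral:
  assumes a: "a > 0" and b: "b > 0" and z: "z \<notin> hyp2F1_cut"
  shows "hyp2F1 \<gamma> (of_real a + \<i> * of_real x) (of_real (a + b)) z *
            (Gamma (of_real a + \<i> * of_real x) * Gamma (of_real b - \<i> * of_real x)) =
         of_real (Gamma (a + b)) *
            (\<integral>u. exp (\<i> * of_real x * of_real u) * hker a b (of_real u) *
               (1 - z * of_real (exp u / (1 + exp u))) powr (- \<gamma>) \<partial>lborel)"
proof -
  let ?t = "\<lambda>u::real. exp u / (1 + exp u)"
  let ?H = "\<lambda>u::real. exp (\<i> * of_real x * of_real u) * hker a b (of_real u)"
  let ?A = "of_real a + \<i> * of_real x" and ?B = "of_real b - \<i> * of_real x"
  have ep: "1 + exp u > 0" for u :: real by (intro add_pos_pos) auto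
  have t01: "0 \<le> ?t u" "?t u \<le> 1" for u using ep[of u] by auto
  have mt: "?t \<in> borel_measurable lborel" by measurable
  have mct: "(\<lambda>u. complex_of_real (?t u)) \<in> borel_measurable lborel" using mt by measurable
  have intH: "integrable lborel ?H" by (rule FT_hker_integrable[OF a b])
  have AB: "?A \<notin> \<int>\<^sub>\<le>\<^sub>0" "?B \<notin> \<int>\<^sub>\<le>\<^sub>0" using a b by (intro Gamma_right_half_plane; simp)+
  then have GA: "Gamma ?A \<noteq> 0" "Gamma ?B \<noteq> 0" "?A \<notin> \<int>\<^sub>\<le>\<^sub>0" by (auto simp: Gamma_eq_zero_iff)
  have Gab: "Gamma (a + b) > 0" using a b by (intro Gamma_real_pos) auto
  define K where "K = of_real (Gamma (a + b)) / (Gamma ?A * Gamma ?B)"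
  define F where "F = (\<lambda>z. K * (\<integral>u. ?H u * (1 - z * of_real (?t u)) powr (- \<gamma>) \<partial>lborel))"
  have "(\<lambda>z. \<integral>u. ?H u * (1 - z * of_real (?t u)) powr (- \<gamma>) \<partial>lborel) holomorphic_on (- hyp2F1_cut)"
  proof (rule holomorphic_integral_param(1))
    show "open (- hyp2F1_cut)" using closed_hyp2F1_cut by (simp add: open_Compl)
    fix z assume z: "z \<in> - hyp2F1_cut"
    have "(\<lambda>u. (1 - z * of_real (?t u)) powr (- \<gamma>)) \<in> borel_measurable lborel"
    proof -
      have "continuous_on (- \<real>\<^sub>\<le>\<^sub>0) (\<lambda>w. w powr (- \<gamma>))"
        by (intro holomorphic_on_imp_continuous_on holomorphic_intros) auto
      moreover have "continuous_on UNIV (\<lambda>u. 1 - z * of_real (?t u))"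
        by (intro continuous_intros) (use ep in \<open>auto simp: less_imp_neq[symmetric]\<close>)
      ultimately have "continuous_on UNIV (\<lambda>u. (1 - z * of_real (?t u)) powr (- \<gamma>))"
        by (rule continuous_on_compose2) (use hyp2F1_kernel_slit[of z, OF _ t01] z in \<open>auto simp del: of_real_divide\<close>)
      then show ?thesis by (simp add: borel_measurable_continuous_onI)
    qed
    then show "(\<lambda>u. ?H u * (1 - z * of_real (?t u)) powr (- \<gamma>)) \<in> borel_measurable lborel"
      by (rule borel_measurable_times[OF borel_measurable_integrable[OF intH]])
  next
    show "(\<lambda>z. ?H u * (1 - z * of_real (?t u)) powr (- \<gamma>)) holomorphic_on (- hyp2F1_cut)" for u
      using hyp2F1_kernel_slit[OF _ t01, of _ u] by (intro holomorphic_intros) auto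
  next
    \<comment> \<open>Near \<open>z0\<close> the power is bounded by compactness of a closed ball
      times [0, 1], uniformly in t; integrability in \<open>u\<close> comes from \<open>?H\<close>
      alone.\<close>
    fix z0 assume z0: "z0 \<in> - hyp2F1_cut"
    have "open (- hyp2F1_cut)" using closed_hyp2F1_cut by (simp add: open_Compl)
    then obtain r where r: "r > 0" "cball z0 r \<subseteq> - hyp2F1_cut"
      using z0 open_contains_cball by blast
    have "continuous_on (- \<real>\<^sub>\<le>\<^sub>0) (\<lambda>w. w powr (- \<gamma>))"
      by (intro holomorphic_on_imp_continuous_on holomorphic_intros) auto
    moreover have "continuous_on (cball z0 r \<times> {0..1}) (\<lambda>y. 1 - fst y * complex_of_real (snd y))"
      by (intro continuous_intros)
    ultimately have "continuous_on (cball z0 r \<times> {0..1}) (\<lambda>y. (1 - fst y * complex_of_real (snd y)) powr (- \<gamma>))"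
      by (rule continuous_on_compose2) (use hyp2F1_kernel_slit r(2) in \<open>force simp: subset_iff\<close>)
    then have "continuous_on (cball z0 r \<times> {0..1}) (\<lambda>(z, t). (1 - z * complex_of_real t) powr (- \<gamma>))"
      by (simp add: case_prod_unfold)
    then have "bounded ((\<lambda>(z, t). (1 - z * complex_of_real t) powr (- \<gamma>)) ` (cball z0 r \<times> {0..1}))"
      by (intro compact_imp_bounded compact_continuous_image compact_Times) auto
    then obtain D where D: "\<And>z t. z \<in> cball z0 r \<Longrightarrow> t \<in> {0..1} \<Longrightarrow> norm ((1 - z * complex_of_real t) powr (- \<gamma>)) \<le> D"
      unfolding bounded_iff by fastforce
    have "norm (?H u * (1 - z * of_real (?t u)) powr (- \<gamma>)) \<le> norm (?H u) * D" if "z \<in> ball z0 r" for z u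
      unfolding norm_mult[of "?H u"] using D[of z "?t u"] that t01[of u] by (intro mult_left_mono) auto
    moreover have "integrable lborel (\<lambda>u. norm (?H u) * D)" using intH by simp
    ultimately show "\<exists>r>0. \<exists>G. integrable lborel G \<and> (\<forall>z\<in>ball z0 r \<inter> - hyp2F1_cut. \<forall>u.
        norm (?H u * (1 - z * of_real (?t u)) powr (- \<gamma>)) \<le> G u)"
      using r(1) by (intro exI[of _ r] conjI exI[of _ "\<lambda>u. norm (?H u) * D"]) auto
  qed
  then have holF: "F holomorphic_on (- hyp2F1_cut)" unfolding F_def by (intro holomorphic_intros)
  have ser: "F w = hyp2F1_series \<gamma> ?A (of_real (a + b)) w" if w: "norm w < 1" for w
  proof -
    have "norm (complex_of_real (?t u)) \<le> 1" for u using t01[of u] by (simp only: norm_of_real)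
    from binomial_series_integral[OF intH mct this w, of \<gamma>]
    have "(\<lambda>n. K * (pochhammer \<gamma> n / fact n * w ^ n * (\<integral>u. ?H u * of_real (?t u) ^ n \<partial>lborel))) sums F w"
      unfolding F_def by (rule sums_mult)
    moreover have "K * (pochhammer \<gamma> n / fact n * w ^ n * (\<integral>u. ?H u * of_real (?t u) ^ n \<partial>lborel)) =
        pochhammer \<gamma> n * pochhammer ?A n / pochhammer (of_real (a + b)) n * w ^ n / fact n" for n
    proof -
      have "hker a b (of_real u) * complex_of_real (?t u) ^ n = hker (a + real n) b (of_real u)" for u
        using hker_mult_left[of "of_real u" a b n] by (simp add: exp_of_real[symmetric])
      then have "(\<integral>u. ?H u * of_real (?t u) ^ n \<partial>lborel) = FT (hker (a + real n) b) x"
        unfolding FT_def by (simp only: mult.assoc)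
      also have "\<dots> = Gamma (of_real (a + real n) + \<i> * of_real x) * Gamma ?B / of_real (Gamma (a + real n + b))"
        by (rule FT_hker) (use a b in auto)
      also have "Gamma (of_real (a + real n) + \<i> * of_real x) = pochhammer ?A n * Gamma ?A"
        using pochhammer_Gamma[OF GA(3), of n] GA(1) by (simp add: field_simps)
      also have "Gamma (a + real n + b) = pochhammer (a + b) n * Gamma (a + b)"
        using pochhammer_Gamma[of "a + b" n] Gab a b by (auto simp: field_simps nonpos_Ints_def)
      finally have e: "(\<integral>u. ?H u * of_real (?t u) ^ n \<partial>lborel) = pochhammer ?A n * Gamma ?A * Gamma ?B /
          of_real (pochhammer (a + b) n * Gamma (a + b))" .
      have pe: "complex_of_real (pochhammer (a + b) n) = pochhammer (of_real (a + b)) n"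
        by (simp only: pochhammer_of_real)
      show ?thesis
        unfolding e K_def of_real_mult pe using GA(1,2) Gab by (simp add: field_simps)
    qed
    ultimately show ?thesis unfolding hyp2F1_series_def by (simp add: sums_iff)
  qed
  have "hyp2F1 \<gamma> ?A (of_real (a + b)) z = F z"
    by (rule hyp2F1_eqI[OF holF ser z])
  then show ?thesis using GA by (simp add: F_def K_def)
qed

section \<open>Expansion of the hypergeometric factor\<close>

text \<open>Principal powers are multiplicative here because the arguments of \<open>p\<close> and
  \<open>q\<close> lie in (- pi/2, pi/2), so their difference stays in (- pi, pi).\<close>

lemma powr_divide_right_half_plane:
  assumes p: "Re p > 0" and q: "Re q > 0"
  shows "q powr s * (p / q) powr s = p powr s"
proof -
  have nz: "p \<noteq> 0" "q \<noteq> 0" using p q by auto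
  have "\<bar>Im (Ln p)\<bar> < pi / 2" "\<bar>Im (Ln q)\<bar> < pi / 2"
    using p q by (auto intro: Re_Ln_pos_lt_imp simp del: divide_const_simps)
  then have "Ln (exp (Ln p - Ln q)) = Ln p - Ln q" by (intro Ln_exp) auto
  then have "Ln (p / q) = Ln p - Ln q" using nz by (simp add: exp_diff)
  moreover have "s * Ln q + s * (Ln p - Ln q) = s * Ln p" by (simp add: algebra_simps)
  ultimately show ?thesis using nz by (simp add: powr_def flip: exp_add)
qed

lemma divide_right_half_plane_slit:
  assumes p: "Re p > 0" and q: "Re q > 0"
  shows "p / q \<notin> \<real>\<^sub>\<le>\<^sub>0"
proof
  assume "p / q \<in> \<real>\<^sub>\<le>\<^sub>0"
  then obtain s where s: "p / q = of_real s" "s \<le> 0" by (auto elim: nonpos_Reals_cases)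
  moreover have "q \<noteq> 0" using q by auto
  ultimately have "p = of_real s * q" by (simp add: divide_eq_eq)
  then have "Re p = s * Re q" by simp
  with s p q show False by (simp add: zero_less_mult_iff)
qed

text \<open>The m of the overview, with \<open>\<omega>\<close> in place of e: it equals 1 - t +
  \<omega> t.\<close>

definition pencil :: "complex \<Rightarrow> complex \<Rightarrow> complex" where
  "pencil \<omega> u = (1 + \<omega> * exp u) / (1 + exp u)"

text \<open>This is the n-th power of the pencil times \<open>hker a a\<close>, expanded through
  pencil = \<omega> + (1 - \<omega>) (1 - t), so that decay and transforms can be read off termwise.
  Powers of 1 - t touch only the second exponent; the first stays free for the Pochhammer factors of
  the polynomial.\<close>

definition pencil_power :: "real \<Rightarrow> complex \<Rightarrow> nat \<Rightarrow> complex \<Rightarrow> complex" where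
  "pencil_power a \<omega> n u =
     (\<Sum>m\<le>n. of_nat (n choose m) * \<omega> ^ (n - m) * (1 - \<omega>) ^ m * hker a (a + real m) u)"

lemma pencil_power_eq:
  assumes "u \<in> strip pi"
  shows "pencil_power a \<omega> n u = pencil \<omega> u ^ n * hker a a u"
proof -
  have nz: "1 + exp u \<noteq> 0" using one_plus_exp_nonpos[OF assms] by auto
  have "pencil \<omega> u = (1 - \<omega>) * (1 / (1 + exp u)) + \<omega>"
    using nz by (simp add: pencil_def field_simps)
  then have "pencil \<omega> u ^ n = (\<Sum>m\<le>n. of_nat (n choose m) * ((1 - \<omega>) * (1 / (1 + exp u))) ^ m * \<omega> ^ (n - m))"
    by (simp only: binomial_ring)
  then have "pencil \<omega> u ^ n * hker a a u =
      (\<Sum>m\<le>n. of_nat (n choose m) * ((1 - \<omega>) * (1 / (1 + exp u))) ^ m * \<omega> ^ (n - m) * hker a a u)"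
    by (simp only: sum_distrib_right)
  also have "\<dots> = pencil_power a \<omega> n u"
    unfolding pencil_power_def hker_mult_right[OF assms, symmetric]
    by (intro sum.cong refl) (simp only: power_mult_distrib mult_ac)
  finally show ?thesis ..
qed

lemma strip_decay_sum:
  assumes "finite A" "\<And>i. i \<in> A \<Longrightarrow> strip_decay \<beta> (H i)" "\<beta> > 0"
  shows "strip_decay \<beta> (\<lambda>u. \<Sum>i\<in>A. H i u)"
  using assms
proof (induction A rule: finite_induct)
  case empty
  then show ?case by (auto simp: strip_decay_def intro!: exI[of _ 1])
next
  case (insert i A)
  then have "strip_decay \<beta> (\<lambda>u. H i u - (-1) * (\<Sum>i\<in>A. H i u))"
    by (intro strip_decay_diff strip_decay_cmult) auto
  with insert show ?case by simp
qed

lemma strip_decay_pencil_power: "a > 0 \<Longrightarrow> strip_decay pi (pencil_power a \<omega> n)"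
  unfolding pencil_power_def[abs_def] by (intro strip_decay_sum strip_decay_cmult strip_decay_hker) auto

text \<open>On this line e^u = - r e^(2 i \<psi>) with r = |e^u|. The identity \<open>key\<close>
  splits the numerator into a multiple of 1 - r and a multiple of 1 + e^u, and |1 - r| \<le> |1 +
  e^u| by the reverse triangle inequality.\<close>

lemma norm_pencil_line:
  assumes \<psi>: "0 < \<psi>" "\<psi> < pi" and \<phi>: "0 < \<phi>" "\<phi> < pi" and u: "Im u = 2 * \<psi> - pi"
  shows "norm (pencil (exp (- 2 * \<i> * of_real \<phi>)) u) \<le> (sin \<phi> + \<bar>sin (\<psi> - \<phi>)\<bar>) / sin \<psi>"
proof -
  define P where "P = exp u"
  define r where "r = exp (Re u)"
  define \<omega> where "\<omega> = exp (- 2 * \<i> * complex_of_real \<phi>)"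
  have "u \<in> strip pi" using \<psi> u by auto
  then have nz: "1 + P \<noteq> 0" unfolding P_def using one_plus_exp_nonpos by force
  have s: "sin \<psi> > 0" "sin \<phi> > 0" using \<psi> \<phi> by (simp_all add: sin_gt_zero)
  have P: "P = - of_real r * exp (\<i> * of_real \<psi>) ^ 2"
  proof -
    have "u = of_real (Re u) + \<i> * of_real (2 * \<psi> - pi)" using u by (simp add: complex_eq_iff)
    then have "P = exp (of_real (Re u) + 2 * (\<i> * of_real \<psi>) - \<i> * of_real pi)"
      unfolding P_def by (metis (no_types, lifting) add_diff_eq mult.left_commute of_real_diff of_real_mult of_real_numeral right_diff_distrib)
    also have "\<dots> = of_real r * exp (2 * (\<i> * of_real \<psi>)) / exp (\<i> * of_real pi)"
      by (simp add: exp_diff exp_add r_def exp_of_real)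
    also have "exp (\<i> * of_real pi) = -1" by (simp add: exp_eq_polar cis_conv_exp[symmetric])
    finally show ?thesis by (simp flip: exp_double)
  qed
  have key: "of_real (sin \<psi>) * (1 + \<omega> * P) =
      exp (- \<i> * of_real \<phi>) * (of_real (sin \<phi>) * exp (\<i> * of_real \<psi>) * of_real (1 - r) + of_real (sin (\<psi> - \<phi>)) * (1 + P))"
  proof -
    define a where "a = exp (\<i> * of_real \<psi>)"
    define b where "b = exp (\<i> * of_real \<phi>)"
    have ab: "a \<noteq> 0" "b \<noteq> 0" by (auto simp: a_def b_def)
    have sa: "complex_of_real (sin \<psi>) = (a - 1 / a) / (2 * \<i>)"
      by (simp add: a_def sin_of_real[symmetric] sin_exp_eq exp_minus inverse_eq_divide)
    have sb: "complex_of_real (sin \<phi>) = (b - 1 / b) / (2 * \<i>)"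
      by (simp add: b_def sin_of_real[symmetric] sin_exp_eq exp_minus inverse_eq_divide)
    have sab: "complex_of_real (sin (\<psi> - \<phi>)) = (a / b - b / a) / (2 * \<i>)"
    proof -
      have "exp (\<i> * of_real (\<psi> - \<phi>)) = a / b" by (simp add: a_def b_def right_diff_distrib exp_diff)
      moreover have "exp (- (\<i> * of_real (\<psi> - \<phi>))) = b / a"
        by (simp add: a_def b_def right_diff_distrib exp_diff)
      ultimately show ?thesis by (simp only: sin_of_real[symmetric] sin_exp_eq)
    qed
    have w: "\<omega> = 1 / b ^ 2"
      by (simp add: \<omega>_def b_def exp_double[symmetric] exp_minus inverse_eq_divide mult.assoc)
    have b': "exp (- \<i> * of_real \<phi>) = 1 / b" by (simp add: b_def exp_minus inverse_eq_divide)
    have P': "P = - of_real r * a ^ 2" using P by (simp add: a_def)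
    show ?thesis
      unfolding sa sb sab w b' P' a_def[symmetric] of_real_diff of_real_1 using ab
      by (simp add: field_simps power2_eq_square)
  qed
  have "norm P = r" by (simp add: P_def r_def)
  then have le: "\<bar>1 - r\<bar> \<le> norm (1 + P)"
    using norm_triangle_ineq3[of 1 "- P"] by simp
  have "sin \<psi> * norm (1 + \<omega> * P) = norm (of_real (sin \<psi>) * (1 + \<omega> * P))"
    using s by (simp add: norm_mult)
  also have "\<dots> = norm (of_real (sin \<phi>) * exp (\<i> * of_real \<psi>) * of_real (1 - r) + of_real (sin (\<psi> - \<phi>)) * (1 + P))"
    unfolding key norm_mult by simp
  also have "\<dots> \<le> sin \<phi> * \<bar>1 - r\<bar> + \<bar>sin (\<psi> - \<phi>)\<bar> * norm (1 + P)"
    using s by (intro order.trans[OF norm_triangle_ineq]) (simp add: norm_mult del: of_real_diff)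
  also have "\<dots> \<le> sin \<phi> * norm (1 + P) + \<bar>sin (\<psi> - \<phi>)\<bar> * norm (1 + P)"
    using le s by (intro add_right_mono mult_left_mono) auto
  finally have "sin \<psi> * norm (1 + \<omega> * P) \<le> (sin \<phi> + \<bar>sin (\<psi> - \<phi>)\<bar>) * norm (1 + P)"
    by (simp add: distrib_right)
  then show ?thesis
    using s nz unfolding pencil_def P_def[symmetric] \<omega>_def[symmetric] norm_divide
    by (simp add: divide_simps mult_ac)
qed

lemma norm_pencil_of_real_le_1:
  assumes "norm \<omega> \<le> 1"
  shows "norm (pencil \<omega> (of_real u)) \<le> 1"
proof -
  have pos: "1 + exp u > 0" by (intro add_pos_pos) auto
  have "norm (1 + \<omega> * exp (complex_of_real u)) \<le> 1 + norm \<omega> * exp u"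
    by (rule order.trans[OF norm_triangle_ineq]) (simp add: norm_mult)
  also have "\<dots> \<le> 1 + exp u" using mult_right_mono[OF assms, of "exp u"] by simp
  finally have "norm (1 + \<omega> * exp (complex_of_real u)) \<le> 1 + exp u" .
  moreover have "norm (1 + exp (complex_of_real u)) = 1 + exp u"
  proof -
    have "1 + exp (complex_of_real u) = of_real (1 + exp u)" by (simp add: exp_of_real)
    then show ?thesis using pos by (simp only: norm_of_real)
  qed
  ultimately show ?thesis using pos by (simp add: pencil_def norm_divide)
qed

text \<open>With y the hypergeometric argument, 1 - y t = (1 - \<rho> m) / (1 - \<rho>). The
  prefactor (1 - \<rho>)^(- \<gamma>) therefore turns Euler's kernel into (1 - \<rho> m)^(-
  \<gamma>), with no change of branch since both numbers have positive real part.\<close>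

theorem hyp2F1_pencil_expansion:
  assumes a: "a > 0" and \<rho>: "norm \<rho> < 1" and \<omega>: "norm \<omega> \<le> 1"
  shows "(\<lambda>n. of_real (Gamma (2 * a)) * (pochhammer \<gamma> n / fact n * \<rho> ^ n * FT (pencil_power a \<omega> n) x)) sums
     ((1 - \<rho>) powr (- \<gamma>) * hyp2F1 \<gamma> (of_real a + \<i> * of_real x) (of_real (2 * a)) ((1 - \<omega>) * \<rho> / (\<rho> - 1)) *
       (Gamma (of_real a + \<i> * of_real x) * Gamma (of_real a - \<i> * of_real x)))"
proof -
  let ?H = "\<lambda>u::real. exp (\<i> * of_real x * of_real u) * hker a a (of_real u)"
  let ?t = "\<lambda>u::real. exp u / (1 + exp u)"
  let ?y = "(1 - \<omega>) * \<rho> / (\<rho> - 1)"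
  have intH: "integrable lborel ?H" by (rule FT_hker_integrable[OF a a])
  have in_strip: "complex_of_real u \<in> strip pi" for u by simp
  have nz: "1 + exp (complex_of_real u) \<noteq> 0" for u using one_plus_exp_nonpos[OF in_strip, of u] by force
  have meas: "(\<lambda>u. pencil \<omega> (complex_of_real u)) \<in> borel_measurable lborel"
  proof -
    have "continuous_on UNIV (\<lambda>u. pencil \<omega> (complex_of_real u))"
      unfolding pencil_def using nz by (intro continuous_intros) blast
    then show ?thesis by (simp add: borel_measurable_continuous_onI)
  qed
  have pos: "Re (1 - w) > 0" if "norm w < 1" for w :: complex
    using that complex_Re_le_cmod[of w] by simp
  have p1: "Re (1 - \<rho>) > 0" by (rule pos[OF \<rho>])
  have ne: "1 - \<rho> \<noteq> 0" "\<rho> - 1 \<noteq> 0" using p1 by auto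
  have p2: "Re (1 - \<rho> * w) > 0" if "norm w \<le> 1" for w
    using mult_left_mono[OF that, of "norm \<rho>"] \<rho> by (intro pos) (simp add: norm_mult)
  \<comment> \<open>1 - y is a quotient of two numbers in the right half-plane, hence never a
    nonpositive real.\<close>
  have y: "?y \<notin> hyp2F1_cut"
  proof
    assume "?y \<in> hyp2F1_cut"
    then have "1 - ?y \<in> \<real>\<^sub>\<le>\<^sub>0" by (simp add: hyp2F1_cut_iff complex_nonpos_Reals_iff)
    moreover have "1 - ?y = (1 - \<rho> * \<omega>) / (1 - \<rho>)" using ne by (simp add: field_simps)
    ultimately show False using divide_right_half_plane_slit[OF p2[OF \<omega>] p1] by simp
  qed
  have kernel: "(1 - \<rho>) powr (- \<gamma>) * (1 - ?y * of_real (?t u)) powr (- \<gamma>) = (1 - \<rho> * pencil \<omega> (of_real u)) powr (- \<gamma>)" for u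
  proof -
    have "1 - ?y * of_real (?t u) = (1 - \<rho> * pencil \<omega> (of_real u)) / (1 - \<rho>)"
      using ne nz[of u] by (simp add: pencil_def exp_of_real[symmetric] divide_simps) (simp add: algebra_simps)
    then show ?thesis
      using powr_divide_right_half_plane[OF p2[OF norm_pencil_of_real_le_1[OF \<omega>]] p1] by simp
  qed
  have "(\<lambda>n. pochhammer \<gamma> n / fact n * \<rho> ^ n * (\<integral>u. ?H u * pencil \<omega> (of_real u) ^ n \<partial>lborel)) sums
           (\<integral>u. ?H u * (1 - \<rho> * pencil \<omega> (of_real u)) powr (- \<gamma>) \<partial>lborel)"
    by (rule binomial_series_integral[OF intH meas norm_pencil_of_real_le_1[OF \<omega>] \<rho>])
  moreover have "(\<integral>u. ?H u * pencil \<omega> (of_real u) ^ n \<partial>lborel) = FT (pencil_power a \<omega> n) x" for n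
    unfolding FT_def pencil_power_eq[OF in_strip] by (simp only: mult_ac)
  moreover have "(\<integral>u. ?H u * (1 - \<rho> * pencil \<omega> (of_real u)) powr (- \<gamma>) \<partial>lborel) =
      (1 - \<rho>) powr (- \<gamma>) * (\<integral>u. ?H u * (1 - ?y * of_real (?t u)) powr (- \<gamma>) \<partial>lborel)"
    unfolding kernel[symmetric] integral_mult_right_zero[symmetric] by (simp only: mult_ac)
  ultimately have "(\<lambda>n. of_real (Gamma (a + a)) * (pochhammer \<gamma> n / fact n * \<rho> ^ n * FT (pencil_power a \<omega> n) x)) sums
      (of_real (Gamma (a + a)) * ((1 - \<rho>) powr (- \<gamma>) * (\<integral>u. ?H u * (1 - ?y * of_real (?t u)) powr (- \<gamma>) \<partial>lborel)))"
    by (intro sums_mult) simp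
  also have "of_real (Gamma (a + a)) * ((1 - \<rho>) powr (- \<gamma>) * (\<integral>u. ?H u * (1 - ?y * of_real (?t u)) powr (- \<gamma>) \<partial>lborel)) =
     (1 - \<rho>) powr (- \<gamma>) * (of_real (Gamma (a + a)) * (\<integral>u. ?H u * (1 - ?y * of_real (?t u)) powr (- \<gamma>) \<partial>lborel))"
    by (simp only: mult_ac)
  also have "\<dots> = (1 - \<rho>) powr (- \<gamma>) * (hyp2F1 \<gamma> (of_real a + \<i> * of_real x) (of_real (a + a)) ?y *
       (Gamma (of_real a + \<i> * of_real x) * Gamma (of_real a - \<i> * of_real x)))"
    by (simp only: hyp2F1_Euler_integral[OF a a y])
  finally show ?thesis by (simp only: mult.assoc mult_2)
qed

text \<open>Off the cut the polynomial is itself the holomorphic extension; on the cut the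
  definition returns the series. So every argument is covered, including the value 2 at angle
  pi/2.\<close>

lemma hyp2F1_terminating:
  "hyp2F1 (- of_nat k) b c z =
     (\<Sum>j\<le>k. pochhammer (- of_nat k) j * pochhammer b j / pochhammer c j * z ^ j / fact j)"
proof -
  let ?p = "\<lambda>z. \<Sum>j\<le>k. pochhammer (- of_nat k) j * pochhammer b j / pochhammer c j * z ^ j / fact j"
  have ser: "hyp2F1_series (- of_nat k) b c z = ?p z" for z
    unfolding hyp2F1_series_def by (rule suminf_finite) (auto simp: pochhammer_of_nat_eq_0_lemma)
  show ?thesis
  proof (cases "z \<in> hyp2F1_cut")
    case True
    then show ?thesis by (simp add: hyp2F1_def ser)
  next
    case False
    then show ?thesis
      by (intro hyp2F1_eqI[of ?p]) (auto simp: ser simp del: divide_const_simps intro!: holomorphic_intros)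
  qed
qed

text \<open>The functional equation of Gamma absorbs the polynomial factor into Gamma (a + j + i x).
  The product is again the transform of a kernel, so inversion applies to it.\<close>

lemma pochhammer_FT_hker:
  assumes "a > 0" "b > 0"
  shows "pochhammer (of_real a + \<i> * of_real x) j * FT (hker a b) x =
           pochhammer (of_real (a + b)) j * FT (hker (a + real j) b) x"
proof -
  let ?A = "of_real a + \<i> * of_real x"
  have A: "?A \<notin> \<int>\<^sub>\<le>\<^sub>0" using assms by (intro Gamma_right_half_plane) simp
  then have GA: "Gamma ?A \<noteq> 0" by (simp add: Gamma_eq_zero_iff)
  have Gab: "Gamma (a + b) > 0" using assms by (intro Gamma_real_pos) auto
  have Gabj: "Gamma (a + real j + b) > 0" using assms by (intro Gamma_real_pos) auto
  have 1: "Gamma (of_real (a + real j) + \<i> * of_real x) = pochhammer ?A j * Gamma ?A"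
    using pochhammer_Gamma[OF A, of j] GA by (simp add: field_simps)
  have 2: "Gamma (a + real j + b) = pochhammer (a + b) j * Gamma (a + b)"
    using pochhammer_Gamma[of "a + b" j] Gab assms by (auto simp: field_simps nonpos_Ints_def)
  then have 3: "pochhammer (a + b) j \<noteq> 0" using Gabj by auto
  have 4: "pochhammer (of_real (a + b)) j = complex_of_real (pochhammer (a + b) j)"
    by (rule pochhammer_of_real)
  have "FT (hker (a + real j) b) x = Gamma (of_real (a + real j) + \<i> * of_real x) *
      Gamma (of_real b - \<i> * of_real x) / of_real (Gamma (a + real j + b))"
    by (rule FT_hker) (use assms in auto)
  then show ?thesis
    unfolding FT_hker[OF assms] 1 2 4 of_real_mult using 3 Gab by simp
qed

section \<open>Moments of the Meixner-Pollaczek polynomials\<close>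

text \<open>At \<open>v\<close>, where inversion is evaluated, 1 + e^v = 2 sin \<psi> e^(v/2) with
  |Im (v/2)| < pi/2. Hence the principal logarithm is explicit, and the phases cancel in
  \<open>hker a a v\<close>.\<close>

lemma imaginary_point:
  fixes \<psi> :: real
  assumes \<psi>: "0 < \<psi>" "\<psi> < pi"
  defines "v \<equiv> \<i> * complex_of_real (2 * \<psi> - pi)"
  shows "exp v = - (exp (\<i> * of_real \<psi>) ^ 2)"
    and "hker a a v = of_real (1 / (2 * sin \<psi>) powr (2 * a))"
    and "1 + exp v \<noteq> 0"
proof -
  have s: "sin \<psi> > 0" using \<psi> by (simp add: sin_gt_zero)
  define E where "E = exp (\<i> * complex_of_real (\<psi> - pi / 2))"
  have v: "exp v = E ^ 2"
    by (simp add: v_def E_def exp_double[symmetric] algebra_simps)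
  have E: "E = - \<i> * exp (\<i> * of_real \<psi>)"
  proof -
    have "E = exp (\<i> * of_real \<psi>) / exp (\<i> * of_real (pi / 2))"
      by (simp add: E_def right_diff_distrib exp_diff)
    also have "exp (\<i> * of_real (pi / 2)) = \<i>"
      by (simp only: cis_conv_exp[symmetric] cis_pi_half)
    finally show ?thesis by (simp add: field_simps)
  qed
  show "exp v = - (exp (\<i> * of_real \<psi>) ^ 2)"
    by (simp add: v E power_mult_distrib)
  have "sin \<psi> = cos (\<psi> - pi / 2)" by (simp add: cos_diff)
  then have "complex_of_real (2 * sin \<psi>) = E + 1 / E"
    by (simp add: E_def cos_of_real[symmetric] cos_exp_eq exp_minus inverse_eq_divide del: of_real_diff)
  moreover have E0: "E \<noteq> 0" by (simp add: E_def)
  ultimately have *: "1 + exp v = of_real (2 * sin \<psi>) * E" by (simp add: v field_simps power2_eq_square)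
  then show "1 + exp v \<noteq> 0" using E0 s by simp
  have "1 + exp v = exp (of_real (ln (2 * sin \<psi>)) + \<i> * complex_of_real (\<psi> - pi / 2))"
    unfolding * exp_add E_def[symmetric] exp_of_real using s by simp
  then have "Ln (1 + exp v) = of_real (ln (2 * sin \<psi>)) + \<i> * complex_of_real (\<psi> - pi / 2)"
    using \<psi> by (simp only:) (intro Ln_exp; simp)
  then have "hker a a v = exp (of_real a * v -
      of_real (a + a) * (of_real (ln (2 * sin \<psi>)) + \<i> * complex_of_real (\<psi> - pi / 2)))"
    by (simp only: hker_def)
  also have "\<dots> = exp (of_real (- (2 * a) * ln (2 * sin \<psi>)))"
    by (simp add: v_def algebra_simps)
  also have "\<dots> = of_real (exp (- (2 * a) * ln (2 * sin \<psi>)))" by (simp only: exp_of_real)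
  also have "exp (- (2 * a) * ln (2 * sin \<psi>)) = 1 / (2 * sin \<psi>) powr (2 * a)"
    using s by (simp add: powr_def exp_minus inverse_eq_divide)
  finally show "hker a a v = of_real (1 / (2 * sin \<psi>) powr (2 * a))" .
qed

lemma hker_shift:
  assumes "u \<in> strip pi"
  shows "hker (a + real j) (b + real m) u = hker a b u * (exp u / (1 + exp u)) ^ j * (1 / (1 + exp u)) ^ m"
  using hker_mult_right[OF assms, of "a + real j" b m] hker_mult_left[OF assms, of a b j] by simp

lemma FT_sum:
  assumes "finite A" "\<And>i. i \<in> A \<Longrightarrow> strip_decay \<beta> (H i)" "\<beta> > 0"
  shows "FT (\<lambda>u. \<Sum>i\<in>A. H i u) x = (\<Sum>i\<in>A. FT (H i) x)"
  unfolding FT_def sum_distrib_left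
  by (rule Bochner_Integration.integral_sum) (use assms FT_integrable in blast)

text \<open>Inversion at i \<theta>, after the Pochhammer factor has been moved into the first
  exponent.\<close>

lemma moment_integral:
  assumes a: "a > 0" and b: "b > 0" and \<theta>: "\<bar>\<theta>\<bar> < pi"
  shows "has_bochner_integral lborel
     (\<lambda>x. of_real (exp (\<theta> * x)) * (pochhammer (of_real a + \<i> * of_real x) j * FT (hker a b) x))
     (pochhammer (of_real (a + b)) j * (2 * of_real pi * hker (a + real j) b (\<i> * of_real \<theta>)))"
proof -
  have "has_bochner_integral lborel (\<lambda>x. exp (- \<i> * of_real x * (\<i> * of_real \<theta>)) * FT (hker (a + real j) b) x)
      (2 * of_real pi * hker (a + real j) b (\<i> * of_real \<theta>))"
    using FT_inversion[OF strip_decay_hker, of "a + real j" b "\<i> * of_real \<theta>"] a b \<theta> by simp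
  then have "has_bochner_integral lborel
     (\<lambda>x. pochhammer (of_real (a + b)) j * (exp (- \<i> * of_real x * (\<i> * of_real \<theta>)) * FT (hker (a + real j) b) x))
     (pochhammer (of_real (a + b)) j * (2 * of_real pi * hker (a + real j) b (\<i> * of_real \<theta>)))"
    by (rule has_bochner_integral_mult_right)
  moreover have "pochhammer (of_real (a + b)) j * (exp (- \<i> * of_real x * (\<i> * of_real \<theta>)) * FT (hker (a + real j) b) x) =
     of_real (exp (\<theta> * x)) * (pochhammer (of_real a + \<i> * of_real x) j * FT (hker a b) x)" for x
  proof -
    have "- \<i> * of_real x * (\<i> * of_real \<theta>) = complex_of_real (\<theta> * x)"
      by (simp add: algebra_simps)
    then have "exp (- \<i> * of_real x * (\<i> * of_real \<theta>)) = complex_of_real (exp (\<theta> * x))"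
      by (simp only: exp_of_real)
    then show ?thesis by (simp only: pochhammer_FT_hker[OF a b] mult.left_commute)
  qed
  ultimately show ?thesis by simp
qed

text \<open>Coefficients of the Meixner-Pollaczek polynomial in the basis of Pochhammer symbols of
  lam + i x, the basis to which \<open>pochhammer_FT_hker\<close> applies.\<close>

definition mp_coeff :: "nat \<Rightarrow> real \<Rightarrow> real \<Rightarrow> nat \<Rightarrow> complex" where
  "mp_coeff k lam \<psi> j =
     of_real (pochhammer (2 * lam) k / fact k) * exp (\<i> * of_nat k * of_real \<psi>) *
     (pochhammer (- of_nat k) j / pochhammer (of_real (2 * lam)) j * (1 - exp (- 2 * \<i> * of_real \<psi>)) ^ j / fact j)"

lemma meixner_pollaczek_eq:
  "meixner_pollaczek k lam x \<psi> =
     (\<Sum>j\<le>k. mp_coeff k lam \<psi> j * pochhammer (of_real lam + \<i> * of_real x) j)"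
  unfolding meixner_pollaczek_def hyp2F1_terminating sum_distrib_left mp_coeff_def
  by (intro sum.cong refl) (simp add: mult_ac)

text \<open>The value of t at \<open>v\<close> is the reciprocal of 1 - exp (-2 i \<psi>), so the
  powers cancel and the sum becomes a 2F1 (-k, 2 lam + m; 2 lam; 1). Chu-Vandermonde gives (-m)_k /
  (2 lam)_k, whose denominator cancels against the normalisation of the polynomial.\<close>

lemma mp_coeff_Vandermonde:
  assumes lam: "lam > 0" and \<psi>: "0 < \<psi>" "\<psi> < pi"
  defines "v \<equiv> \<i> * complex_of_real (2 * \<psi> - pi)"
  shows "(\<Sum>j\<le>k. mp_coeff k lam \<psi> j * (exp v / (1 + exp v)) ^ j * pochhammer (of_real (2 * lam + real m)) j) =
           exp (\<i> * of_nat k * of_real \<psi>) / fact k * pochhammer (- of_nat m) k"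
proof -
  let ?Z = "1 - exp (- 2 * \<i> * complex_of_real \<psi>)"
  let ?c = "complex_of_real (2 * lam)"
  have nc: "?c + of_nat i \<noteq> 0" for i
  proof -
    have "Re (?c + of_nat i) > 0" using lam by simp
    then show ?thesis by (metis less_irrefl zero_complex.sel(1))
  qed
  have Zt: "?Z * (exp v / (1 + exp v)) = 1"
  proof -
    define w where "w = exp (\<i> * complex_of_real \<psi>)"
    have "?Z = 1 - 1 / w ^ 2"
      by (simp add: w_def exp_double[symmetric] exp_minus inverse_eq_divide mult.assoc)
    moreover have "w \<noteq> 0" by (simp add: w_def)
    moreover have "exp v = - (w ^ 2)" "1 + exp v \<noteq> 0"
      using imaginary_point(1,3)[OF \<psi>] by (simp_all add: v_def w_def)
    ultimately show ?thesis by (simp add: field_simps)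
  qed
  have pc: "pochhammer ?c k \<noteq> 0"
    using nc by (auto simp: pochhammer_eq_0_iff eq_neg_iff_add_eq_0)
  have e: "mp_coeff k lam \<psi> j * (exp v / (1 + exp v)) ^ j * pochhammer (of_real (2 * lam + real m)) j =
      of_real (pochhammer (2 * lam) k / fact k) * exp (\<i> * of_nat k * of_real \<psi>) *
      ((pochhammer (?c + of_nat m) j * pochhammer (- of_nat k) j) / (of_nat (fact j) * pochhammer ?c j))" for j
  proof -
    have "mp_coeff k lam \<psi> j * (exp v / (1 + exp v)) ^ j * pochhammer (of_real (2 * lam + real m)) j =
      of_real (pochhammer (2 * lam) k / fact k) * exp (\<i> * of_nat k * of_real \<psi>) *
      (pochhammer (- of_nat k) j / pochhammer ?c j * (?Z * (exp v / (1 + exp v))) ^ j / fact j) * pochhammer (?c + of_nat m) j"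
      unfolding mp_coeff_def power_mult_distrib by (simp add: mult_ac)
    then show ?thesis unfolding Zt by (simp add: mult_ac)
  qed
  have "(\<Sum>j\<le>k. mp_coeff k lam \<psi> j * (exp v / (1 + exp v)) ^ j * pochhammer (of_real (2 * lam + real m)) j) =
    of_real (pochhammer (2 * lam) k / fact k) * exp (\<i> * of_nat k * of_real \<psi>) *
    (\<Sum>j=0..k. (pochhammer (?c + of_nat m) j * pochhammer (- of_nat k) j) / (of_nat (fact j) * pochhammer ?c j))"
    unfolding e sum_distrib_left by (simp add: atLeast0AtMost)
  also have "(\<Sum>j=0..k. (pochhammer (?c + of_nat m) j * pochhammer (- of_nat k) j) / (of_nat (fact j) * pochhammer ?c j)) =
      pochhammer (?c - (?c + of_nat m)) k / pochhammer ?c k"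
    by (rule Vandermonde_pochhammer) (use nc in \<open>auto simp: eq_neg_iff_add_eq_0\<close>)
  also have "of_real (pochhammer (2 * lam) k / fact k) * exp (\<i> * of_nat k * of_real \<psi>) * (pochhammer (?c - (?c + of_nat m)) k / pochhammer ?c k) =
     exp (\<i> * of_nat k * of_real \<psi>) / fact k * pochhammer (- of_nat m) k"
  proof -
    have "complex_of_real (pochhammer (2 * lam) k / fact k) = pochhammer ?c k / fact k"
      by (simp only: pochhammer_of_real of_real_divide of_real_fact)
    then show ?thesis using pc by simp
  qed
  finally show ?thesis .
qed

text \<open>Both expansions are finite: the pencil power over \<open>m\<close>, the polynomial over
  \<open>j\<close>. For fixed \<open>m\<close> the factor t^j (1 - t)^m at \<open>v\<close> splits
  off from \<open>hker lam lam v\<close>, and the sum over \<open>j\<close> is of Vandermonde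
  type.\<close>

lemma pencil_moment_integral:
  assumes lam: "lam > 0" and \<psi>: "0 < \<psi>" "\<psi> < pi"
  defines "v \<equiv> \<i> * complex_of_real (2 * \<psi> - pi)"
  shows "has_bochner_integral lborel
     (\<lambda>x. of_real (exp ((2 * \<psi> - pi) * x)) * meixner_pollaczek k lam x \<psi> * FT (pencil_power lam \<omega> n) x)
     (of_real (2 * pi / (2 * sin \<psi>) powr (2 * lam)) * (exp (\<i> * of_nat k * of_real \<psi>) / fact k) *
      (\<Sum>m\<le>n. of_nat (n choose m) * \<omega> ^ (n - m) * ((1 - \<omega>) / (1 + exp v)) ^ m * pochhammer (- of_nat m) k))"
proof -
  let ?\<theta> = "2 * \<psi> - pi"
  let ?d = "\<lambda>m. of_nat (n choose m) * \<omega> ^ (n - m) * (1 - \<omega>) ^ m"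
  let ?A = "\<lambda>x::real. of_real lam + \<i> * complex_of_real x"
  let ?V = "\<lambda>m j. pochhammer (of_real (lam + (lam + real m))) j * (2 * of_real pi * hker (lam + real j) (lam + real m) v)"
  have \<theta>: "\<bar>?\<theta>\<bar> < pi" using \<psi> by auto
  have vs: "v \<in> strip pi" using \<theta> by (simp add: v_def)
  have "has_bochner_integral lborel
     (\<lambda>x. \<Sum>m\<le>n. \<Sum>j\<le>k. ?d m * mp_coeff k lam \<psi> j *
        (of_real (exp (?\<theta> * x)) * (pochhammer (?A x) j * FT (hker lam (lam + real m)) x)))
     (\<Sum>m\<le>n. \<Sum>j\<le>k. ?d m * mp_coeff k lam \<psi> j * ?V m j)"
    unfolding v_def
    by (intro has_bochner_integral_sum has_bochner_integral_mult_right moment_integral \<theta>) (use lam in auto)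
  moreover have "(\<Sum>m\<le>n. \<Sum>j\<le>k. ?d m * mp_coeff k lam \<psi> j *
        (of_real (exp (?\<theta> * x)) * (pochhammer (?A x) j * FT (hker lam (lam + real m)) x))) =
      of_real (exp (?\<theta> * x)) * meixner_pollaczek k lam x \<psi> * FT (pencil_power lam \<omega> n) x" for x
  proof -
    have "FT (pencil_power lam \<omega> n) x = (\<Sum>m\<le>n. ?d m * FT (hker lam (lam + real m)) x)"
      unfolding pencil_power_def[abs_def] using lam
      by (subst FT_sum[where \<beta>=pi]) (auto intro!: strip_decay_cmult strip_decay_hker simp: FT_cmult)
    then show ?thesis
      unfolding meixner_pollaczek_eq
      by (simp only: sum_distrib_left sum_distrib_right) (simp only: mult_ac)
  qed
  moreover have "(\<Sum>m\<le>n. \<Sum>j\<le>k. ?d m * mp_coeff k lam \<psi> j * ?V m j) =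
     of_real (2 * pi / (2 * sin \<psi>) powr (2 * lam)) * (exp (\<i> * of_nat k * of_real \<psi>) / fact k) *
      (\<Sum>m\<le>n. of_nat (n choose m) * \<omega> ^ (n - m) * ((1 - \<omega>) / (1 + exp v)) ^ m * pochhammer (- of_nat m) k)"
  proof -
    have "(\<Sum>j\<le>k. ?d m * mp_coeff k lam \<psi> j * ?V m j) =
      of_real (2 * pi / (2 * sin \<psi>) powr (2 * lam)) * (exp (\<i> * of_nat k * of_real \<psi>) / fact k) *
      (of_nat (n choose m) * \<omega> ^ (n - m) * ((1 - \<omega>) / (1 + exp v)) ^ m * pochhammer (- of_nat m) k)" for m
    proof -
      have "(\<Sum>j\<le>k. ?d m * mp_coeff k lam \<psi> j * ?V m j) =
        ?d m * (1 / (1 + exp v)) ^ m * (2 * of_real pi * hker lam lam v) *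
        (\<Sum>j\<le>k. mp_coeff k lam \<psi> j * (exp v / (1 + exp v)) ^ j * pochhammer (of_real (2 * lam + real m)) j)"
      proof -
        have "lam + (lam + real m) = 2 * lam + real m" by simp
        then show ?thesis
          unfolding hker_shift[OF vs] sum_distrib_left by (intro sum.cong refl) (simp only: mult_ac)
      qed
      also have "\<dots> = ?d m * (1 / (1 + exp v)) ^ m * (2 * of_real pi * of_real (1 / (2 * sin \<psi>) powr (2 * lam))) *
         (exp (\<i> * of_nat k * of_real \<psi>) / fact k * pochhammer (- of_nat m) k)"
        unfolding v_def mp_coeff_Vandermonde[OF lam \<psi>] imaginary_point(2)[OF \<psi>] ..
      finally show ?thesis by (simp add: power_divide mult_ac)
    qed
    then show ?thesis by (simp only: sum_distrib_left)
  qed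
  ultimately show ?thesis by simp
qed

section \<open>Closed forms for the sums over m and n\<close>

lemma pochhammer_minus_of_nat:
  "pochhammer (- of_nat m :: complex) k = (-1) ^ k * fact k * of_nat (m choose k)"
  by (simp add: binomial_gbinomial gbinomial_pochhammer flip: power_mult_distrib)

text \<open>Up to sign \<open>pochhammer (- of_nat m) k\<close> is a falling factorial of
  \<open>m\<close>, so the left side is (- X)^k times the k-th derivative of (\<omega> + X)^n in X.
  The proof is algebraic, by trinomial revision of the binomial coefficients.\<close>

lemma sum_binomial_falling:
  fixes \<omega> X :: complex
  shows "(\<Sum>m\<le>n. of_nat (n choose m) * \<omega> ^ (n - m) * X ^ m * pochhammer (- of_nat m) k) =
           (-1) ^ k * fact k * of_nat (n choose k) * X ^ k * (\<omega> + X) ^ (n - k)"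
proof (cases "k \<le> n")
  case False
  then show ?thesis by (auto simp: pochhammer_minus_of_nat binomial_eq_0 intro!: sum.neutral)
next
  case True
  then obtain l where n: "n = k + l" using le_Suc_ex by blast
  let ?f = "\<lambda>m. of_nat (n choose m) * \<omega> ^ (n - m) * X ^ m * pochhammer (- of_nat m) k"
  have "(\<Sum>m\<le>n. ?f m) = (\<Sum>m\<in>{k..k+l}. ?f m)"
    by (rule sum.mono_neutral_right) (auto simp: n pochhammer_minus_of_nat binomial_eq_0)
  also have "\<dots> = (\<Sum>i\<in>{0..l}. ?f (i + k))"
    using sum.shift_bounds_cl_nat_ivl[of ?f 0 k l] by (simp add: add.commute)
  also have "\<dots> = (\<Sum>i\<le>l. (-1) ^ k * fact k * of_nat (n choose k) * X ^ k * (of_nat (l choose i) * X ^ i * \<omega> ^ (l - i)))"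
    unfolding atLeast0AtMost
  proof (intro sum.cong refl)
    fix i assume i: "i \<in> {..l}"
    have "(n choose (i + k)) * ((i + k) choose k) = (n choose k) * (l choose i)"
      using choose_mult[of k "i + k" n] i by (simp add: n)
    then have c: "complex_of_nat (n choose (i + k)) * of_nat ((i + k) choose k) = of_nat (n choose k) * of_nat (l choose i)"
      by (simp only: of_nat_mult[symmetric])
    have "?f (i + k) = (-1) ^ k * fact k * (complex_of_nat (n choose (i + k)) * of_nat ((i + k) choose k)) * X ^ (i + k) * \<omega> ^ (l - i)"
      unfolding pochhammer_minus_of_nat by (simp add: n)
    then show "?f (i + k) = (-1) ^ k * fact k * of_nat (n choose k) * X ^ k * (of_nat (l choose i) * X ^ i * \<omega> ^ (l - i))"
      unfolding c by (simp add: power_add)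
  qed
  also have "\<dots> = (-1) ^ k * fact k * of_nat (n choose k) * X ^ k * (\<Sum>i\<le>l. of_nat (l choose i) * X ^ i * \<omega> ^ (l - i))"
    by (simp only: sum_distrib_left)
  also have "(\<Sum>i\<le>l. of_nat (l choose i) * X ^ i * \<omega> ^ (l - i)) = (\<omega> + X) ^ (n - k)"
    using binomial_ring[of X \<omega> l] by (simp add: n add.commute)
  finally show ?thesis .
qed

text \<open>Terms with n < k vanish. For n = l + k, the factorisation (\<gamma>)_(l+k) =
  (\<gamma>)_k (\<gamma> + k)_l leaves the binomial series with exponent - \<gamma> - k.\<close>

lemma shifted_binomial_series:
  fixes \<gamma> \<rho> Y :: complex
  assumes "norm (\<rho> * Y) < 1"
  shows "(\<lambda>n. pochhammer \<gamma> n / fact n * \<rho> ^ n * (fact k * of_nat (n choose k) * Y ^ (n - k))) sums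
           (pochhammer \<gamma> k * \<rho> ^ k * (1 - \<rho> * Y) powr (- \<gamma> - of_nat k))"
proof -
  let ?f = "\<lambda>n. pochhammer \<gamma> n / fact n * \<rho> ^ n * (fact k * of_nat (n choose k) * Y ^ (n - k))"
  have "(\<lambda>l. pochhammer \<gamma> k * \<rho> ^ k * (pochhammer (\<gamma> + of_nat k) l / fact l * (\<rho> * Y) ^ l)) sums
     (pochhammer \<gamma> k * \<rho> ^ k * (1 - \<rho> * Y) powr (- (\<gamma> + of_nat k)))"
    by (intro sums_mult binomial_series_sums assms)
  moreover have "pochhammer \<gamma> k * \<rho> ^ k * (pochhammer (\<gamma> + of_nat k) l / fact l * (\<rho> * Y) ^ l) = ?f (l + k)" for l
  proof -
    have "complex_of_nat (l + k choose k) = fact (l + k) / (fact k * fact l)"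
      using binomial_fact[of k "l + k", where 'a=complex] by simp
    moreover have "pochhammer \<gamma> (l + k) = pochhammer \<gamma> k * pochhammer (\<gamma> + of_nat k) l"
      by (simp add: pochhammer_product'[symmetric] add.commute)
    ultimately show ?thesis by (simp add: power_add power_mult_distrib)
  qed
  ultimately have "(\<lambda>l. ?f (l + k)) sums (pochhammer \<gamma> k * \<rho> ^ k * (1 - \<rho> * Y) powr (- \<gamma> - of_nat k))"
    by simp
  moreover have "(\<Sum>n<k. ?f n) = 0" by (auto simp: binomial_eq_0 intro!: sum.neutral)
  ultimately show ?thesis using sums_iff_shift'[of ?f k] by simp
qed

text \<open>Polynomial growth is absorbed by an arbitrarily slow exponential. The rate varies in the
  induction because each new factor consumes half of it.\<close>

lemma pochhammer_exp_bound:
  fixes a \<epsilon> :: real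
  assumes "\<epsilon> > 0"
  shows "\<exists>D\<ge>0. \<forall>x. norm (pochhammer (of_real a + \<i> * of_real x) j) \<le> D * exp (\<epsilon> * \<bar>x\<bar>)"
  using assms
proof (induction j arbitrary: \<epsilon>)
  case 0
  then show ?case by (intro exI[of _ 1]) auto
next
  case (Suc j)
  from Suc.IH[of "\<epsilon> / 2"] Suc.prems obtain D where
    D: "D \<ge> 0" "\<And>x. norm (pochhammer (of_real a + \<i> * of_real x) j) \<le> D * exp (\<epsilon> / 2 * \<bar>x\<bar>)" by auto
  \<comment> \<open>The summand 2 / \<epsilon> comes from y \<le> e^y at y = \<epsilon> |x| / 2,
    which bounds the linear growth in \<open>x\<close>.\<close>
  let ?D = "\<bar>a\<bar> + real j + 2 / \<epsilon>"
  have "norm (pochhammer (of_real a + \<i> * of_real x) (Suc j)) \<le> (D * ?D) * exp (\<epsilon> * \<bar>x\<bar>)" for x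
  proof -
    have "norm (of_real a + \<i> * of_real x + of_nat j) \<le> \<bar>a\<bar> + \<bar>x\<bar> + real j"
      by (intro order.trans[OF norm_triangle_ineq] add_mono) (auto simp: norm_mult)
    also have "\<dots> \<le> ?D * exp (\<epsilon> / 2 * \<bar>x\<bar>)"
    proof -
      have "1 \<le> exp (\<epsilon> / 2 * \<bar>x\<bar>)" using Suc.prems by simp
      then have 1: "(\<bar>a\<bar> + real j) * 1 \<le> (\<bar>a\<bar> + real j) * exp (\<epsilon> / 2 * \<bar>x\<bar>)" by (intro mult_left_mono) auto
      have "\<epsilon> / 2 * \<bar>x\<bar> \<le> exp (\<epsilon> / 2 * \<bar>x\<bar>)"
        using exp_ge_add_one_self[of "\<epsilon> / 2 * \<bar>x\<bar>"] by linarith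
      then have "2 / \<epsilon> * (\<epsilon> / 2 * \<bar>x\<bar>) \<le> 2 / \<epsilon> * exp (\<epsilon> / 2 * \<bar>x\<bar>)" using Suc.prems by (intro mult_left_mono) auto
      then have "\<bar>x\<bar> \<le> 2 / \<epsilon> * exp (\<epsilon> / 2 * \<bar>x\<bar>)" using Suc.prems by simp
      with 1 show ?thesis by (simp only: distrib_right mult_1_right) 
    qed
    finally have 2: "norm (of_real a + \<i> * of_real x + of_nat j) \<le> ?D * exp (\<epsilon> / 2 * \<bar>x\<bar>)" .
    have "norm (pochhammer (of_real a + \<i> * of_real x) (Suc j)) \<le> (D * exp (\<epsilon> / 2 * \<bar>x\<bar>)) * (?D * exp (\<epsilon> / 2 * \<bar>x\<bar>))"
      unfolding pochhammer_Suc norm_mult using D 2 by (intro mult_mono) auto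
    also have "\<dots> = (D * ?D) * exp (\<epsilon> / 2 * \<bar>x\<bar> + \<epsilon> / 2 * \<bar>x\<bar>)" by (simp only: exp_add mult_ac)
    also have "\<epsilon> / 2 * \<bar>x\<bar> + \<epsilon> / 2 * \<bar>x\<bar> = \<epsilon> * \<bar>x\<bar>" by simp
    finally show ?thesis .
  qed
  then show ?case using D(1) Suc.prems by (intro exI[of _ "D * ?D"]) auto
qed

lemma meixner_pollaczek_exp_bound:
  assumes "\<epsilon> > 0"
  obtains D where "D \<ge> 0" "\<And>x. norm (meixner_pollaczek k lam x \<psi>) \<le> D * exp (\<epsilon> * \<bar>x\<bar>)"
proof -
  have "\<forall>j. \<exists>D\<ge>0. \<forall>x. norm (pochhammer (of_real lam + \<i> * of_real x) j) \<le> D * exp (\<epsilon> * \<bar>x\<bar>)"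
    using pochhammer_exp_bound[OF assms] by blast
  then obtain D where D: "\<And>j. D j \<ge> 0"
    "\<And>j x. norm (pochhammer (of_real lam + \<i> * of_real x) j) \<le> D j * exp (\<epsilon> * \<bar>x\<bar>)" by metis
  show thesis
  proof
    show "(\<Sum>j\<le>k. norm (mp_coeff k lam \<psi> j) * D j) \<ge> 0" using D by (intro sum_nonneg) auto
    fix x
    have "norm (meixner_pollaczek k lam x \<psi>) \<le> (\<Sum>j\<le>k. norm (mp_coeff k lam \<psi> j) * (D j * exp (\<epsilon> * \<bar>x\<bar>)))"
      unfolding meixner_pollaczek_eq
      by (intro sum_norm_le) (auto simp: norm_mult intro!: mult_left_mono D)
    then show "norm (meixner_pollaczek k lam x \<psi>) \<le> (\<Sum>j\<le>k. norm (mp_coeff k lam \<psi> j) * D j) * exp (\<epsilon> * \<bar>x\<bar>)"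
      by (simp only: sum_distrib_right mult.assoc)
  qed
qed

text \<open>The angle \<open>p\<close> is independent of the weight, so that angles on both sides of
  \<psi> can be inserted. \<open>I\<close> is the integral of |hker| over the line Im u = 2 p - pi;
  the dependence on \<open>n\<close> is purely geometric.\<close>

lemma FT_pencil_power_bound:
  assumes lam: "lam > 0" and p: "0 < p" "p < pi" and \<phi>: "0 < \<phi>" "\<phi> < pi"
  obtains I where "I \<ge> 0" "\<And>n x. norm (FT (pencil_power lam (exp (- 2 * \<i> * of_real \<phi>)) n) x) \<le>
     exp (- (x * (2 * p - pi))) * (I * ((sin \<phi> + \<bar>sin (p - \<phi>)\<bar>) / sin p) ^ n)"
proof -
  let ?s = "2 * p - pi"
  let ?\<omega> = "exp (- 2 * \<i> * complex_of_real \<phi>)"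
  let ?B = "(sin \<phi> + \<bar>sin (p - \<phi>)\<bar>) / sin p"
  let ?u = "\<lambda>u::real. of_real u + \<i> * complex_of_real ?s"
  have s: "\<bar>?s\<bar> < pi" using p by auto
  have us: "?u u \<in> strip pi" for u using s by simp
  have int: "integrable lborel (\<lambda>u. norm (hker lam lam (?u u)))"
    using strip_decay_integrable[OF strip_decay_hker[OF lam lam], of "\<i> * complex_of_real ?s"] s by simp
  have intp: "integrable lborel (\<lambda>u. norm (pencil_power lam ?\<omega> n (?u u)))" for n
    using strip_decay_integrable[OF strip_decay_pencil_power[OF lam], of "\<i> * complex_of_real ?s"] s by simp
  have "norm (pencil_power lam ?\<omega> n (?u u)) \<le> norm (hker lam lam (?u u)) * ?B ^ n" for n u
    unfolding pencil_power_eq[OF us] norm_mult norm_power mult.commute[of "norm (hker lam lam (?u u))"]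
    by (intro mult_right_mono power_mono norm_pencil_line p \<phi>) auto
  then have le: "(\<integral>u. norm (pencil_power lam ?\<omega> n (?u u)) \<partial>lborel) \<le> (\<integral>u. norm (hker lam lam (?u u)) * ?B ^ n \<partial>lborel)" for n
    by (intro integral_mono intp integrable_mult_left int)
  show thesis
  proof
    show "(\<integral>u. norm (hker lam lam (?u u)) \<partial>lborel) \<ge> 0" by simp
    fix n x
    have "norm (FT (pencil_power lam ?\<omega> n) x) \<le> exp (- (x * ?s)) * (\<integral>u. norm (pencil_power lam ?\<omega> n (?u u)) \<partial>lborel)"
      by (rule FT_bound_line[OF strip_decay_pencil_power[OF lam] s])
    also have "\<dots> \<le> exp (- (x * ?s)) * (\<integral>u. norm (hker lam lam (?u u)) * ?B ^ n \<partial>lborel)"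
      by (intro mult_left_mono le) auto
    finally show "norm (FT (pencil_power lam ?\<omega> n) x) \<le> exp (- (x * ?s)) * ((\<integral>u. norm (hker lam lam (?u u)) \<partial>lborel) * ?B ^ n)"
      by simp
  qed
qed

section \<open>Termwise integration of the expansion in \<rho>\<close>

theorem corollary6p10:
  fixes k :: nat and lam \<psi> \<phi> :: real and \<gamma> \<rho> :: complex
  assumes "lam > 0"
    and "0 < \<psi>" "\<psi> < pi" and "0 < \<phi>" "\<phi> < pi"
    and "norm \<rho> * (sin \<phi> + \<bar>sin (\<psi> - \<phi>)\<bar>) < sin \<psi>"
  shows "has_bochner_integral lborel
     (\<lambda>x::real. (1 - \<rho>) powr (- \<gamma>) *
        hyp2F1 \<gamma> (of_real lam + \<i> * of_real x) (of_real (2 * lam))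
               ((1 - exp (- 2 * \<i> * of_real \<phi>)) * \<rho> / (\<rho> - 1)) *
        of_real (exp ((2 * \<psi> - pi) * x)) *
        of_real ((norm (Gamma (of_real lam + \<i> * of_real x :: complex)))\<^sup>2) *
        meixner_pollaczek k lam x \<psi>)
     ((1 - \<rho> * of_real (sin (\<psi> - \<phi>)) / (exp (\<i> * of_real \<phi>) * of_real (sin \<psi>)))
          powr (- \<gamma> - of_nat k) *
      of_real (sin \<phi> / sin \<psi>) ^ k *
      (pochhammer \<gamma> k * of_real (Gamma (2 * lam)) * of_real (2 * pi) * \<rho> ^ k /
       (exp (\<i> * of_nat k * of_real \<phi>) * of_real ((2 * sin \<psi>) powr (2 * lam)) * fact k)))"
proof -
  let ?\<omega> = "exp (- 2 * \<i> * complex_of_real \<phi>)"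
  let ?\<theta> = "2 * \<psi> - pi"
  define v where "v = \<i> * complex_of_real ?\<theta>"
  \<comment> \<open>\<open>X\<close> is (1 - \<omega>) (1 - t) at \<open>v\<close>, and
    \<open>Y\<close> is the pencil at \<open>v\<close>; they are what the sum over \<open>m\<close>
    leaves behind.\<close>
  define X where "X = (1 - ?\<omega>) / (1 + exp v)"
  define Y where "Y = ?\<omega> + X"
  have s: "sin \<psi> > 0" "sin \<phi> > 0" using assms by (simp_all add: sin_gt_zero)
  \<comment> \<open>sin \<psi> = sin (\<phi> + (\<psi> - \<phi>)) is at most sin \<phi> + |sin
    (\<psi> - \<phi>)|, so the hypothesis forces |\<rho>| < 1.\<close>
  have \<rho>1: "norm \<rho> < 1"
  proof -
    have "sin \<psi> = sin \<phi> * cos (\<psi> - \<phi>) + cos \<phi> * sin (\<psi> - \<phi>)"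
      using sin_add[of \<phi> "\<psi> - \<phi>"] by simp
    also have "\<dots> \<le> sin \<phi> * 1 + \<bar>cos \<phi> * sin (\<psi> - \<phi>)\<bar>"
      using s by (intro add_mono mult_left_mono) auto
    also have "\<bar>cos \<phi> * sin (\<psi> - \<phi>)\<bar> \<le> 1 * \<bar>sin (\<psi> - \<phi>)\<bar>"
      unfolding abs_mult by (intro mult_right_mono) auto
    finally have le: "sin \<psi> \<le> sin \<phi> + \<bar>sin (\<psi> - \<phi>)\<bar>" by simp
    show ?thesis
    proof (rule ccontr)
      assume "\<not> norm \<rho> < 1"
      then have "1 * (sin \<phi> + \<bar>sin (\<psi> - \<phi>)\<bar>) \<le> norm \<rho> * (sin \<phi> + \<bar>sin (\<psi> - \<phi>)\<bar>)"
        using s by (intro mult_right_mono) auto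
      with le assms(6) show False by simp
    qed
  qed
  have XY: "X = - of_real (sin \<phi> / sin \<psi>) / (exp (\<i> * of_real \<phi>) * exp (\<i> * of_real \<psi>))"
    "Y = of_real (sin (\<psi> - \<phi>)) / (exp (\<i> * of_real \<phi>) * of_real (sin \<psi>))"
  proof -
    define a where "a = exp (\<i> * complex_of_real \<psi>)"
    define b where "b = exp (\<i> * complex_of_real \<phi>)"
    have ab: "a \<noteq> 0" "b \<noteq> 0" by (auto simp: a_def b_def)
    have sa: "complex_of_real (sin \<psi>) = (a ^ 2 - 1) / (2 * \<i> * a)"
      using ab by (simp add: a_def sin_of_real[symmetric] sin_exp_eq exp_minus field_simps power2_eq_square)
    have sb: "complex_of_real (sin \<phi>) = (b ^ 2 - 1) / (2 * \<i> * b)"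
      using ab by (simp add: b_def sin_of_real[symmetric] sin_exp_eq exp_minus field_simps power2_eq_square)
    have sab: "complex_of_real (sin (\<psi> - \<phi>)) = (a / b - b / a) / (2 * \<i>)"
    proof -
      have "exp (\<i> * of_real (\<psi> - \<phi>)) = a / b" by (simp add: a_def b_def right_diff_distrib exp_diff)
      moreover have "exp (- (\<i> * of_real (\<psi> - \<phi>))) = b / a"
        by (simp add: a_def b_def right_diff_distrib exp_diff)
      ultimately show ?thesis by (simp only: sin_of_real[symmetric] sin_exp_eq)
    qed
    have w: "?\<omega> = 1 / b ^ 2"
      by (simp add: b_def exp_double[symmetric] exp_minus inverse_eq_divide mult.assoc)
    have ev: "exp v = - (a ^ 2)" and nz: "1 + exp v \<noteq> 0"
      using imaginary_point(1,3)[OF assms(2,3)] by (simp_all add: v_def a_def)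
    have a1: "1 - a ^ 2 \<noteq> 0" "a ^ 2 - 1 \<noteq> 0" using nz ev by auto
    show X: "X = - of_real (sin \<phi> / sin \<psi>) / (exp (\<i> * of_real \<phi>) * exp (\<i> * of_real \<psi>))"
      unfolding X_def w ev of_real_divide sa sb a_def[symmetric] b_def[symmetric]
      using ab a1 by (simp add: divide_simps) (simp add: algebra_simps power2_eq_square)
    show "Y = of_real (sin (\<psi> - \<phi>)) / (exp (\<i> * of_real \<phi>) * of_real (sin \<psi>))"
      unfolding Y_def X_def w ev sa sab b_def[symmetric]
      using ab a1 by (simp add: divide_simps) (simp add: algebra_simps power2_eq_square)
  qed
  have \<rho>Y: "norm (\<rho> * Y) < 1"
  proof -
    have "norm \<rho> * \<bar>sin (\<psi> - \<phi>)\<bar> \<le> norm \<rho> * (sin \<phi> + \<bar>sin (\<psi> - \<phi>)\<bar>)"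
      using s by (intro mult_left_mono) auto
    with assms(6) have "norm \<rho> * \<bar>sin (\<psi> - \<phi>)\<bar> < sin \<psi>" by linarith
    then show ?thesis using s by (simp add: XY norm_mult norm_divide divide_less_eq)
  qed
  let ?B = "\<lambda>p. (sin \<phi> + \<bar>sin (p - \<phi>)\<bar>) / sin p"
  \<comment> \<open>The strict inequality persists, by continuity in \<open>p\<close>, at two angles
    on either side of \<psi>.\<close>
  obtain \<delta> where \<delta>: "\<delta> > 0" "\<And>p. p \<in> {\<psi> + \<delta>, \<psi> - \<delta>} \<Longrightarrow> 0 < p \<and> p < pi \<and> norm \<rho> * ?B p < 1"
  proof -
    define g where "g = (\<lambda>p. norm \<rho> * ?B p)"
    have "isCont g \<psi>" unfolding g_def using s by (intro continuous_intros) auto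
    then have "(g \<longlongrightarrow> g \<psi>) (nhds \<psi>)" by (simp add: isCont_def tendsto_at_iff_tendsto_nhds)
    moreover have "g \<psi> < 1" using assms(6) s by (simp add: g_def divide_less_eq)
    ultimately have "\<forall>\<^sub>F p in nhds \<psi>. g p < 1" by (rule order_tendstoD(2))
    then have "\<forall>\<^sub>F p in nhds \<psi>. norm \<rho> * ?B p < 1" by (simp only: g_def)
    moreover have "\<forall>\<^sub>F p in nhds \<psi>. p \<in> {0<..<pi}"
      by (rule eventually_nhds_in_open) (use assms in auto)
    ultimately have "\<forall>\<^sub>F p in nhds \<psi>. 0 < p \<and> p < pi \<and> norm \<rho> * ?B p < 1"
      by eventually_elim auto
    then obtain d where d: "d > 0" "\<And>p. dist p \<psi> < d \<Longrightarrow> 0 < p \<and> p < pi \<and> norm \<rho> * ?B p < 1"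
      by (auto simp: eventually_nhds_metric)
    show thesis
    proof (rule that[of "d / 2"])
      fix p assume "p \<in> {\<psi> + d / 2, \<psi> - d / 2}"
      then have "dist p \<psi> < d" using d(1) by (auto simp: dist_real_def)
      then show "0 < p \<and> p < pi \<and> norm \<rho> * ?B p < 1" by (rule d(2))
    qed (use d(1) in simp)
  qed
  have p1: "0 < \<psi> + \<delta>" "\<psi> + \<delta> < pi" "norm \<rho> * ?B (\<psi> + \<delta>) < 1"
    and p2: "0 < \<psi> - \<delta>" "\<psi> - \<delta> < pi" "norm \<rho> * ?B (\<psi> - \<delta>) < 1"
    using \<delta>(2)[of "\<psi> + \<delta>"] \<delta>(2)[of "\<psi> - \<delta>"] by auto
  obtain I1 where I1: "I1 \<ge> 0" "\<And>n x. norm (FT (pencil_power lam ?\<omega> n) x) \<le>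
     exp (- (x * (2 * (\<psi> + \<delta>) - pi))) * (I1 * ?B (\<psi> + \<delta>) ^ n)"
    using FT_pencil_power_bound[OF assms(1) p1(1,2) assms(4,5)] by blast
  obtain I2 where I2: "I2 \<ge> 0" "\<And>n x. norm (FT (pencil_power lam ?\<omega> n) x) \<le>
     exp (- (x * (2 * (\<psi> - \<delta>) - pi))) * (I2 * ?B (\<psi> - \<delta>) ^ n)"
    using FT_pencil_power_bound[OF assms(1) p2(1,2) assms(4,5)] by blast
  define R where "R = max (?B (\<psi> + \<delta>)) (?B (\<psi> - \<delta>))"
  have B0: "?B (\<psi> + \<delta>) \<ge> 0" "?B (\<psi> - \<delta>) \<ge> 0"
    using s p1 p2 by (auto intro!: divide_nonneg_pos add_nonneg_nonneg sin_gt_zero)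
  have R: "R \<ge> 0" "norm \<rho> * R < 1" using B0 p1(3) p2(3) by (auto simp: R_def max_def)
  define I where "I = max I1 I2"
  have FT_le: "exp (?\<theta> * x) * norm (FT (pencil_power lam ?\<omega> n) x) \<le> I * R ^ n * exp (- (2 * \<delta> * \<bar>x\<bar>))" for n x
  proof -
    have 1: "I1 * ?B (\<psi> + \<delta>) ^ n \<le> I * R ^ n" "I2 * ?B (\<psi> - \<delta>) ^ n \<le> I * R ^ n"
      using I1(1) I2(1) B0 by (auto intro!: mult_mono power_mono simp: I_def R_def)
    \<comment> \<open>The sign of \<open>q\<close> follows that of \<open>x\<close>: the weight
      times the factor at angle \<psi> + q is exp (- 2 q x) = exp (- 2 \<delta> |x|).\<close>
    obtain q where q: "q = \<delta> \<or> q = - \<delta>" "- (q * x) = - (\<delta> * \<bar>x\<bar>)"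
      by (rule that[of "if x \<ge> 0 then \<delta> else - \<delta>"]) auto
    have "norm (FT (pencil_power lam ?\<omega> n) x) \<le> exp (- (x * (2 * (\<psi> + q) - pi))) * (I * R ^ n)"
      using q(1)
    proof
      assume "q = \<delta>"
      then show ?thesis
        using order.trans[OF I1(2)[of n x] mult_left_mono[OF 1(1) exp_ge_zero]] by simp
    next
      assume "q = - \<delta>"
      then show ?thesis
        using order.trans[OF I2(2)[of n x] mult_left_mono[OF 1(2) exp_ge_zero]] by simp
    qed
    then have "exp (?\<theta> * x) * norm (FT (pencil_power lam ?\<omega> n) x) \<le>
        exp (?\<theta> * x) * (exp (- (x * (2 * (\<psi> + q) - pi))) * (I * R ^ n))"
      by (rule mult_left_mono) simp
    also have "\<dots> = I * R ^ n * exp (?\<theta> * x + - (x * (2 * (\<psi> + q) - pi)))"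
      by (simp only: exp_add mult_ac)
    also have "?\<theta> * x + - (x * (2 * (\<psi> + q) - pi)) = 2 * - (q * x)" by (simp add: algebra_simps)
    finally show ?thesis by (simp only: q(2)) (simp only: mult_minus_right mult.assoc)
  qed
  \<comment> \<open>The polynomial spends half of the rate 2 \<delta>; the other half makes the
    dominating function integrable.\<close>
  obtain D where D: "D \<ge> 0" "\<And>x. norm (meixner_pollaczek k lam x \<psi>) \<le> D * exp (\<delta> * \<bar>x\<bar>)"
    using meixner_pollaczek_exp_bound[OF \<delta>(1)] by blast
  define c where "c = (\<lambda>n. of_real (Gamma (2 * lam)) * (pochhammer \<gamma> n / fact n * \<rho> ^ n))"
  define f where "f = (\<lambda>n x. c n * (of_real (exp (?\<theta> * x)) * meixner_pollaczek k lam x \<psi> * FT (pencil_power lam ?\<omega> n) x))"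
  define K where "K = complex_of_real (2 * pi / (2 * sin \<psi>) powr (2 * lam)) * (exp (\<i> * of_nat k * of_real \<psi>) / fact k)"
  have f_int: "has_bochner_integral lborel (f n)
      (c n * (K * ((-1) ^ k * fact k * of_nat (n choose k) * X ^ k * Y ^ (n - k))))" for n
    unfolding f_def K_def Y_def sum_binomial_falling[symmetric] X_def v_def
    by (intro has_bochner_integral_mult_right pencil_moment_integral assms)
  have f_le: "norm (f n x) \<le> norm (c n) * R ^ n * (D * I * exp (- (\<delta> * \<bar>x\<bar>)))" for n x
  proof -
    have "norm (f n x) = norm (c n) * (norm (meixner_pollaczek k lam x \<psi>) * (exp (?\<theta> * x) * norm (FT (pencil_power lam ?\<omega> n) x)))"
      by (simp add: f_def norm_mult mult_ac)
    also have "\<dots> \<le> norm (c n) * ((D * exp (\<delta> * \<bar>x\<bar>)) * (I * R ^ n * exp (- (2 * \<delta> * \<bar>x\<bar>))))"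
      using D by (intro mult_left_mono mult_mono FT_le) auto
    also have "\<dots> = norm (c n) * R ^ n * (D * I * exp (\<delta> * \<bar>x\<bar> + - (2 * \<delta> * \<bar>x\<bar>)))"
      by (simp only: exp_add mult_ac)
    also have "\<delta> * \<bar>x\<bar> + - (2 * \<delta> * \<bar>x\<bar>) = - (\<delta> * \<bar>x\<bar>)" by simp
    finally show ?thesis .
  qed
  have summ: "summable (\<lambda>n. norm (c n) * R ^ n)"
  proof -
    have "norm (c n) * R ^ n = \<bar>Gamma (2 * lam)\<bar> * (norm (pochhammer \<gamma> n / fact n) * (norm \<rho> * R) ^ n)" for n
      by (simp add: c_def norm_mult norm_divide norm_power power_mult_distrib)
    then show ?thesis
      using binomial_series_abs_summable[of "norm \<rho> * R" \<gamma>] R by (simp only:) (intro summable_mult; simp)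
  qed
  have G: "integrable lborel (\<lambda>x. D * I * exp (- (\<delta> * \<bar>x\<bar>)))"
    using integrable_exp_neg_abs[OF \<delta>(1)] by simp
  let ?F = "\<lambda>x::real. (1 - \<rho>) powr (- \<gamma>) *
        hyp2F1 \<gamma> (of_real lam + \<i> * of_real x) (of_real (2 * lam)) ((1 - ?\<omega>) * \<rho> / (\<rho> - 1)) *
        of_real (exp (?\<theta> * x)) *
        of_real ((norm (Gamma (of_real lam + \<i> * of_real x :: complex)))\<^sup>2) *
        meixner_pollaczek k lam x \<psi>"
  have f_sums: "(\<lambda>n. f n x) sums ?F x" for x
  proof -
    \<comment> \<open>Gamma commutes with conjugation, which turns the squared modulus into the
      Gamma product of the expansion.\<close>
    have G2: "of_real ((norm (Gamma (of_real lam + \<i> * of_real x :: complex)))\<^sup>2) =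
        Gamma (of_real lam + \<i> * of_real x) * Gamma (of_real lam - \<i> * of_real x)"
      by (simp add: complex_norm_square cnj_Gamma del: of_real_power)
    have "norm ?\<omega> \<le> 1" by simp
    from sums_mult[OF hyp2F1_pencil_expansion[OF assms(1) \<rho>1 this, of \<gamma> x],
        of "of_real (exp (?\<theta> * x)) * meixner_pollaczek k lam x \<psi>"]
    show ?thesis unfolding f_def c_def G2 by (simp only: mult_ac)
  qed
  have int: "integrable lborel (f n)" for n using f_int[of n] by (simp add: has_bochner_integral_iff)
  have "integrable lborel ?F" by (rule integrable_dominated_sums[OF int f_le summ G f_sums])
  moreover have "integral\<^sup>L lborel ?F = K * of_real (Gamma (2 * lam)) * (- X) ^ k *
      (pochhammer \<gamma> k * \<rho> ^ k * (1 - \<rho> * Y) powr (- \<gamma> - of_nat k))"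
  proof -
    have "(\<lambda>n. integral\<^sup>L lborel (f n)) sums integral\<^sup>L lborel ?F"
      by (rule integral_dominated_sums[OF int f_le summ G f_sums])
    moreover have "integral\<^sup>L lborel (f n) = K * of_real (Gamma (2 * lam)) * (- X) ^ k *
        (pochhammer \<gamma> n / fact n * \<rho> ^ n * (fact k * of_nat (n choose k) * Y ^ (n - k)))" for n
    proof -
      \<comment> \<open>The sign of the falling factorial is absorbed here.\<close>
      have "(- X) ^ k = (-1) ^ k * X ^ k" by (rule power_minus)
      then show ?thesis using f_int[of n] by (simp add: has_bochner_integral_iff c_def mult_ac)
    qed
    moreover have "(\<lambda>n. K * of_real (Gamma (2 * lam)) * (- X) ^ k *
        (pochhammer \<gamma> n / fact n * \<rho> ^ n * (fact k * of_nat (n choose k) * Y ^ (n - k)))) sums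
       (K * of_real (Gamma (2 * lam)) * (- X) ^ k *
         (pochhammer \<gamma> k * \<rho> ^ k * (1 - \<rho> * Y) powr (- \<gamma> - of_nat k)))"
      by (intro sums_mult shifted_binomial_series \<rho>Y)
    ultimately show ?thesis using sums_unique2 by simp
  qed
  moreover have "K * of_real (Gamma (2 * lam)) * (- X) ^ k *
      (pochhammer \<gamma> k * \<rho> ^ k * (1 - \<rho> * Y) powr (- \<gamma> - of_nat k)) =
     (1 - \<rho> * of_real (sin (\<psi> - \<phi>)) / (exp (\<i> * of_real \<phi>) * of_real (sin \<psi>)))
          powr (- \<gamma> - of_nat k) *
      of_real (sin \<phi> / sin \<psi>) ^ k *
      (pochhammer \<gamma> k * of_real (Gamma (2 * lam)) * of_real (2 * pi) * \<rho> ^ k /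
       (exp (\<i> * of_nat k * of_real \<phi>) * of_real ((2 * sin \<psi>) powr (2 * lam)) * fact k))"
  proof -
    have e: "exp (\<i> * of_nat k * complex_of_real t) = exp (\<i> * of_real t) ^ k" for t
      by (simp add: exp_of_nat_mult[symmetric] mult_ac)
    \<comment> \<open>The factor e^(- i k \<psi>) cancels the e^(i k \<psi>) that \<open>K\<close>
      inherits from the polynomial; only e^(- i k \<phi>) survives.\<close>
    have x: "(- X) ^ k = of_real (sin \<phi> / sin \<psi>) ^ k / (exp (\<i> * of_real \<phi>) ^ k * exp (\<i> * of_real \<psi>) ^ k)"
      by (simp add: XY(1) power_divide power_mult_distrib)
    have y: "1 - \<rho> * Y = 1 - \<rho> * of_real (sin (\<psi> - \<phi>)) / (exp (\<i> * of_real \<phi>) * of_real (sin \<psi>))"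
      by (simp add: XY(2))
    show ?thesis
      unfolding x y[symmetric] K_def e of_real_divide[of "2 * pi"] by (simp add: mult_ac)
  qed
  ultimately show ?thesis by (simp only: has_bochner_integral_iff)
qed

end
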